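(* Let $0<a<1$, and let $X_1,X_2,\dots$ be independent random points, each uniformly distributed on the rotational ellipsoid $E=\{(x_1,x_2,x_3)\in\mathbb{R}^3: x_1^2+x_2^2+x_3^2/a^2\le 1\}$. For $n\ge 2$ let $M_n=\max_{1\le i<j\le n}\|X_i-X_j\|$, where $\|\cdot\|$ is the Euclidean norm. Then, as $n\to\infty$, $n^{4/7}(2-M_n)$ converges in distribution to a random variable $Z$ with \[ \mathbb{P}(Z>t)=\exp\{-\Lambda_a t^{7/2}\},\qquad t\ge 0. \] Moreover, \[ \Lambda_a=\frac{9}{64\pi}I_a, \] where \[ I_a=\int_A \mathbf{1}\{G(s,s',y,y',\tau)\le 1\}\,\mathrm{d}s\,\mathrm{d}s'\,\mathrm{d}y\,\mathrm{d}y'\,\mathrm{d}\tau, \] \[ G(s,s',y,y',\tau)=\frac{s+s'}{2}+\frac{\tau^2}{4}-\frac{a^2}{4}(y-y')^2, \] and \[ A=\{(s,s',y,y',\tau)\in\mathbb{R}^5: s,s'\ge 0,\ y^2\le s,\ (y')^2\le s'\}. \]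
   Context: $\mathbf{1}\{\cdot\}$ denotes an indicator function, and the integral is with respect to five-dimensional Lebesgue measure. "Uniformly distributed on $E$" means with respect to normalized Lebesgue measure on $E$. *)

theory Defs
  imports "HOL-Probability.Probability"
begin

definition ellipsoid :: "real \<Rightarrow> (real ^ 3) set" where
  "ellipsoid a = {x. (x $ 1)\<^sup>2 + (x $ 2)\<^sup>2 + (x $ 3)\<^sup>2 / a\<^sup>2 \<le> 1}"

text \<open>The maximum below is over the empty set, hence unspecified, when \<open>n < 2\<close>.\<close>

definition max_interpoint_dist :: "(nat \<Rightarrow> 'w \<Rightarrow> real ^ 3) \<Rightarrow> nat \<Rightarrow> 'w \<Rightarrow> real" where
  "max_interpoint_dist X n \<omega> = Max {norm (X i \<omega> - X j \<omega>) | i j. 1 \<le> i \<and> i < j \<and> j \<le> n}"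

definition G_fun :: "real \<Rightarrow> real \<Rightarrow> real \<Rightarrow> real \<Rightarrow> real \<Rightarrow> real \<Rightarrow> real" where
  "G_fun a s s' y y' \<tau> = (s + s') / 2 + \<tau>\<^sup>2 / 4 - a\<^sup>2 / 4 * (y - y')\<^sup>2"

definition A_set :: "(real \<times> real \<times> real \<times> real \<times> real) set" where
  "A_set = {(s, s', y, y', \<tau>). 0 \<le> s \<and> 0 \<le> s' \<and> y\<^sup>2 \<le> s \<and> y'\<^sup>2 \<le> s'}"

definition I_const :: "real \<Rightarrow> real" where
  "I_const a = set_lebesgue_integral lborel A_set (\<lambda>(s, s', y, y', \<tau>). of_bool (G_fun a s s' y y' \<tau> \<le> 1))"

end

theory Submission
  imports Defs
begin

text \<open>
  The pairs at distance at least \<open>2 - \<epsilon>\<close> are rare events, and two of them are independent unless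
  the pairs share a point; a Stein--Chen type argument reduces the theorem to the asymptotics of
  the probability of a single such pair, together with a uniform bound \<open>O(\<epsilon>\<^sup>2)\<close> on the
  conditional probability given one of the points.

  For the asymptotics, rotate the first point into the plane \<open>x\<^sub>2 = 0\<close>, so that
  \<open>x = (sqrt (1 - \<epsilon> s), 0, a sqrt \<epsilon> y)\<close>, and write the second point as
  \<open>(-1 + \<epsilon> w / 2, sqrt \<epsilon> \<tau>, a sqrt \<epsilon> y')\<close>. The squared radius of a uniform point of a disc is
  uniform, so this scaling is affine in every integration variable and contributes exactly the factor
  \<open>\<pi> a\<^sup>2 \<epsilon> powr (7/2) / 2\<close>. The scaled regions stay in a fixed box and converge; dominated convergence
  and the shear \<open>w = s' + \<tau>\<^sup>2\<close> give \<open>I_const\<close>.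
\<close>

section \<open>Void probabilities of dissociated events\<close>

text \<open>Two exponents govern the argument. Near an antipodal pair of equatorial points, two
  depths scale like \<epsilon> and three offsets like sqrt \<epsilon>, while the angle around the
  equator is free; a pair is therefore far with probability of order \<epsilon>^(7/2). With about
  n^2/2 pairs the balance is \<epsilon> = t n^(-4/7). Given one point, one depth and two offsets
  remain, hence the order \<epsilon>^2. As n^2 \<epsilon>^(7/2) stays bounded, overlapping pairs
  contribute an error of order n \<epsilon>^2, that is n^(-1/7): a thin margin, but enough. The
  maximal distance 2 is attained on a whole circle of antipodal pairs. The hypothesis a < 1 makes
  the distance drop off that circle at a rate controlled by 1 - a^2, and this quantity sets the size
  of the box that dominates all scaled regions. The constant 9/(64 \<pi>) is the product of two
  normalizations 3/(4 \<pi> a), the scaling factor \<pi> a^2/2, and 1/2 for unordered pairs.\<close>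

lemma (in prob_space) expectation_bounded_nat:
  fixes f :: "nat \<Rightarrow> real"
  assumes W: "W \<in> measurable M (count_space UNIV)" and le: "\<And>\<omega>. \<omega> \<in> space M \<Longrightarrow> W \<omega> \<le> N"
  shows "expectation (\<lambda>\<omega>. f (W \<omega>)) = (\<Sum>k\<le>N. f k * prob {\<omega> \<in> space M. W \<omega> = k})"
proof -
  have [measurable]: "{\<omega> \<in> space M. W \<omega> = k} \<in> events" for k
    using W by measurable
  have "expectation (\<lambda>\<omega>. f (W \<omega>))
      = expectation (\<lambda>\<omega>. \<Sum>k\<le>N. f k * indicator {\<omega> \<in> space M. W \<omega> = k} \<omega>)"
  proof (rule Bochner_Integration.integral_cong)
    fix \<omega> assume "\<omega> \<in> space M"
    then have "(\<Sum>k\<le>N. f k * indicator {\<omega> \<in> space M. W \<omega> = k} \<omega>)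
      = (\<Sum>k\<le>N. if k = W \<omega> then f k else 0)"
      by (intro sum.cong) (auto simp: indicator_def)
    also have "\<dots> = f (W \<omega>)"
      using le[OF \<open>\<omega> \<in> space M\<close>] by simp
    finally show "f (W \<omega>) = (\<Sum>k\<le>N. f k * indicator {\<omega> \<in> space M. W \<omega> = k} \<omega>)" ..
  qed simp
  also have "\<dots> = (\<Sum>k\<le>N. f k * prob {\<omega> \<in> space M. W \<omega> = k})"
    by (subst Bochner_Integration.integral_sum) (auto intro!: integrable_real_mult_indicator simp: emeasure_eq_measure)
  finally show ?thesis .
qed

text \<open>Integrating factor: \<open>exp (- l * u) * \<phi> u\<close> has derivative
  \<open>exp (- l * u) * (\<phi>' u - l * \<phi> u)\<close>, bounded by \<open>d\<close> because
  \<open>0 \<le> l\<close>, and the mean value theorem compares the endpoints. Starting from the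
  known value at 1 and going down to 0 keeps the error free of a factor growing with
  \<open>l\<close>.\<close>

lemma approximate_exponential_ode:
  fixes \<phi> \<phi>' :: "real \<Rightarrow> real"
  assumes deriv: "\<And>u. 0 \<le> u \<Longrightarrow> u \<le> 1 \<Longrightarrow> (\<phi> has_real_derivative \<phi>' u) (at u)"
    and close: "\<And>u. 0 \<le> u \<Longrightarrow> u \<le> 1 \<Longrightarrow> \<bar>\<phi>' u - l * \<phi> u\<bar> \<le> d"
    and "\<phi> 1 = 1" "0 \<le> l"
  shows "\<bar>\<phi> 0 - exp (- l)\<bar> \<le> d"
proof -
  define g where "g u = exp (- l * u) * \<phi> u" for u
  have "\<exists>z. 0 < z \<and> z < 1 \<and> g 1 - g 0 = (1 - 0) * (exp (- l * z) * (\<phi>' z - l * \<phi> z))"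
  proof (rule MVT2)
    fix u :: real assume "0 \<le> u" "u \<le> 1"
    then show "(g has_real_derivative exp (- l * u) * (\<phi>' u - l * \<phi> u)) (at u)"
      unfolding g_def by (auto intro!: derivative_eq_intros deriv simp: algebra_simps)
  qed simp
  then obtain z where z: "0 < z" "z < 1" "g 1 - g 0 = exp (- l * z) * (\<phi>' z - l * \<phi> z)" by auto
  have "\<bar>g 1 - g 0\<bar> \<le> 1 * d"
    unfolding z(3) abs_mult using z assms by (intro mult_mono close) auto
  then show ?thesis using assms by (simp add: g_def abs_minus_commute)
qed

text \<open>Bernoulli's inequality bounds \<open>1 - u ^ k\<close> by \<open>k * (1 - u)\<close>.
  This is the price, uniform in \<open>u\<close>, of dropping \<open>k\<close> events from a count
  in the exponent.\<close>

lemma power_diff_le: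
  fixes u :: real
  assumes "0 \<le> u" "u \<le> 1"
  shows "\<bar>u ^ (m + k) - u ^ m\<bar> \<le> real k"
proof -
  have "1 - real k * (1 - u) \<le> u ^ k"
    using Bernoulli_inequality[of "u - 1" k] assms by (simp add: algebra_simps)
  moreover have "real k * (1 - u) \<le> real k * 1" using assms by (intro mult_left_mono) auto
  ultimately have "1 - u ^ k \<le> real k" "u ^ k \<le> 1" "0 \<le> 1 - u ^ k"
    using assms by (auto simp: power_le_one)
  moreover have "\<bar>u ^ (m + k) - u ^ m\<bar> = u ^ m * (1 - u ^ k)"
  proof -
    have "u ^ (m + k) - u ^ m = - (u ^ m * (1 - u ^ k))" by (simp add: power_add algebra_simps)
    moreover have "0 \<le> u ^ m * (1 - u ^ k)" using assms \<open>0 \<le> 1 - u ^ k\<close> by simp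
    ultimately show ?thesis by simp
  qed
  moreover have "u ^ m * (1 - u ^ k) \<le> 1 * (1 - u ^ k)"
    using calculation assms by (intro mult_right_mono) (auto simp: power_le_one)
  ultimately show ?thesis by simp
qed

text \<open>The generating function \<open>\<phi> u = E (u ^ W)\<close> of the number \<open>W\<close> of events that occur satisfies
  \<open>\<phi>' = \<Sum>\<alpha>. E (1\<^sub>\<alpha> u ^ (W - 1))\<close>, which is close to \<open>card S * p * \<phi>\<close> when each event is
  independent of all but a few others.\<close>

lemma (in prob_space) dissociated_void_probability:
  fixes A :: "'i \<Rightarrow> 'a set" and nb :: "'i \<Rightarrow> 'i set"
  assumes fin: "finite S" and A[measurable]: "\<And>\<alpha>. \<alpha> \<in> S \<Longrightarrow> A \<alpha> \<in> events"
    and p: "\<And>\<alpha>. \<alpha> \<in> S \<Longrightarrow> prob (A \<alpha>) = p"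
    and q: "\<And>\<alpha> \<beta>. \<alpha> \<in> S \<Longrightarrow> \<beta> \<in> S \<Longrightarrow> \<beta> \<in> nb \<alpha> \<Longrightarrow> \<beta> \<noteq> \<alpha> \<Longrightarrow> prob (A \<alpha> \<inter> A \<beta>) \<le> q"
    and m: "\<And>\<alpha>. \<alpha> \<in> S \<Longrightarrow> card (S \<inter> nb \<alpha>) \<le> m"
    and self: "\<And>\<alpha>. \<alpha> \<in> S \<Longrightarrow> \<alpha> \<in> nb \<alpha>" and "0 \<le> q"
    and indep: "\<And>\<alpha> u. \<alpha> \<in> S \<Longrightarrow> expectation (\<lambda>\<omega>. indicator (A \<alpha>) \<omega> * u ^ card {\<beta> \<in> S - nb \<alpha>. \<omega> \<in> A \<beta>})
      = prob (A \<alpha>) * expectation (\<lambda>\<omega>. u ^ card {\<beta> \<in> S - nb \<alpha>. \<omega> \<in> A \<beta>})"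
  shows "\<bar>prob {\<omega> \<in> space M. \<forall>\<alpha>\<in>S. \<omega> \<notin> A \<alpha>} - exp (- (real (card S) * p))\<bar>
    \<le> real (card S) * (real m * q + real m * p\<^sup>2)"
proof -
  define W where "W \<omega> = card {\<beta> \<in> S. \<omega> \<in> A \<beta>}" for \<omega>
  have W_sum: "card {\<beta> \<in> T. \<omega> \<in> A \<beta>} = (\<Sum>\<beta>\<in>T. of_bool (\<omega> \<in> A \<beta>) :: nat)" if "T \<subseteq> S" for T \<omega>
    using finite_subset[OF that fin] by (subst card_eq_sum, intro sum.mono_neutral_cong_left) auto
  have W_meas: "(\<lambda>\<omega>. card {\<beta> \<in> T. \<omega> \<in> A \<beta>}) \<in> measurable M (count_space UNIV)" if "T \<subseteq> S" for T
  proof -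
    have [measurable]: "\<beta> \<in> T \<Longrightarrow> A \<beta> \<in> events" for \<beta> using that by auto
    show ?thesis unfolding W_sum[OF that] by measurable
  qed
  have W_le: "W \<omega> \<le> card S" for \<omega> unfolding W_def by (intro card_mono fin) auto
  define \<phi> where "\<phi> u = expectation (\<lambda>\<omega>. u ^ W \<omega>)" for u :: real
  \<comment> \<open>The truncated \<open>W \<omega> - 1\<close> at \<open>W \<omega> = 0\<close> is
    harmless, since the factor \<open>W \<omega>\<close> vanishes there.\<close>
  define \<phi>' where "\<phi>' u = expectation (\<lambda>\<omega>. real (W \<omega>) * u ^ (W \<omega> - 1))" for u :: real
  have Wm: "W \<in> measurable M (count_space UNIV)" unfolding W_def by (rule W_meas) auto
  have "(\<phi> has_real_derivative \<phi>' u) (at u)" for u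
  proof -
    \<comment> \<open>As \<open>W\<close> takes finitely many values, the generating function is a
      polynomial in \<open>u\<close> and is differentiated termwise.\<close>
    have 1: "\<phi> = (\<lambda>u. \<Sum>k\<le>card S. u ^ k * prob {\<omega> \<in> space M. W \<omega> = k})"
      unfolding \<phi>_def using expectation_bounded_nat[OF Wm W_le, of "\<lambda>k. _ ^ k"] by auto
    have 2: "\<phi>' u = (\<Sum>k\<le>card S. real k * u ^ (k - 1) * prob {\<omega> \<in> space M. W \<omega> = k})"
      unfolding \<phi>'_def by (rule expectation_bounded_nat[OF Wm W_le])
    show ?thesis unfolding 1 2
      by (auto intro!: derivative_eq_intros simp: mult_ac)
  qed
  moreover have "\<bar>\<phi>' u - real (card S) * p * \<phi> u\<bar> \<le> real (card S) * (real m * q + real m * p\<^sup>2)"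
    if u: "0 \<le> u" "u \<le> 1" for u
  proof -
    have pw: "0 \<le> u ^ k" "u ^ k \<le> 1" for k using u by (auto simp: power_le_one)
    \<comment> \<open>Two exchanges. On \<open>A \<alpha>\<close>, replacing \<open>W - 1\<close> by
      the count \<open>V\<close> outside the neighbourhood costs the expected number of further
      neighbours occurring jointly with \<alpha>, at most \<open>m * q\<close>. Independence then
      splits off the factor \<open>p\<close>, and returning from \<open>V\<close> to
      \<open>W\<close> costs \<open>p\<close> times the expected number of neighbours, at most
      \<open>m * p\<close>.\<close>
    have single: "\<bar>expectation (\<lambda>\<omega>. indicator (A \<alpha>) \<omega> * u ^ (W \<omega> - 1)) - p * \<phi> u\<bar> \<le> real m * q + real m * p\<^sup>2"
      if \<alpha>: "\<alpha> \<in> S" for \<alpha>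
    proof -
      define N where "N = S \<inter> nb \<alpha>"
      define V where "V \<omega> = card {\<beta> \<in> S - nb \<alpha>. \<omega> \<in> A \<beta>}" for \<omega>
      have [measurable]: "A \<alpha> \<in> events" using \<alpha> by auto
      have [measurable]: "W \<in> measurable M (count_space UNIV)" by fact
      have [measurable]: "V \<in> measurable M (count_space UNIV)" unfolding V_def by (rule W_meas) auto
      have \<alpha>N: "\<alpha> \<in> N" using self \<alpha> by (auto simp: N_def)
      have finN: "finite N" using fin by (auto simp: N_def)
      have [measurable]: "\<beta> \<in> N \<Longrightarrow> A \<beta> \<in> events" for \<beta> by (auto simp: N_def)
      have WV: "W \<omega> = V \<omega> + card {\<beta> \<in> N. \<omega> \<in> A \<beta>}" for \<omega>
        unfolding W_def V_def N_def using fin by (subst card_Un_disjoint[symmetric]) (auto intro!: arg_cong[where f=card])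
      have Nsum: "real (card {\<beta> \<in> N. \<omega> \<in> A \<beta>}) = (\<Sum>\<beta>\<in>N. indicator (A \<beta>) \<omega>)" for \<omega>
        by (subst W_sum) (auto simp: N_def indicator_def of_bool_def intro!: sum.cong)
      \<comment> \<open>On \<open>A \<alpha>\<close> the count includes \<alpha> itself, so the
        subtraction of naturals does not truncate.\<close>
      have Nsum': "real (card {\<beta> \<in> N. \<omega> \<in> A \<beta>} - 1) = (\<Sum>\<beta>\<in>N-{\<alpha>}. indicator (A \<beta>) \<omega>)"
        if "\<omega> \<in> A \<alpha>" for \<omega>
      proof -
        have "\<alpha> \<in> {\<beta> \<in> N. \<omega> \<in> A \<beta>}" using \<alpha>N that by auto
        then have "1 \<le> card {\<beta> \<in> N. \<omega> \<in> A \<beta>}" using finN by (auto simp: Suc_le_eq card_gt_0_iff)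
        then have "real (card {\<beta> \<in> N. \<omega> \<in> A \<beta>} - 1) = real (card {\<beta> \<in> N. \<omega> \<in> A \<beta>}) - 1" by simp
        also have "\<dots> = (\<Sum>\<beta>\<in>N-{\<alpha>}. indicator (A \<beta>) \<omega>)"
          unfolding Nsum using \<alpha>N finN that by (subst sum.remove[of _ \<alpha>]) auto
        finally show ?thesis .
      qed
      have card: "real (card N) \<le> real m" using m[OF \<alpha>] by (simp add: N_def)
      have p0: "0 \<le> p" using p[OF \<alpha>] measure_nonneg[of M "A \<alpha>"] by simp
      have ints: "integrable M (\<lambda>\<omega>. u ^ W \<omega>)" "integrable M (\<lambda>\<omega>. u ^ V \<omega>)"
        "integrable M (\<lambda>\<omega>. indicator (A \<alpha>) \<omega> * u ^ (W \<omega> - 1))"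
        "integrable M (\<lambda>\<omega>. indicator (A \<alpha>) \<omega> * u ^ V \<omega>)"
        using pw by (auto intro!: integrable_const_bound[where B=1] simp: indicator_def)
      have "\<bar>expectation (\<lambda>\<omega>. indicator (A \<alpha>) \<omega> * u ^ (W \<omega> - 1)) - expectation (\<lambda>\<omega>. indicator (A \<alpha>) \<omega> * u ^ V \<omega>)\<bar>
        = \<bar>expectation (\<lambda>\<omega>. indicator (A \<alpha>) \<omega> * u ^ (W \<omega> - 1) - indicator (A \<alpha>) \<omega> * u ^ V \<omega>)\<bar>"
        using ints by simp
      also have "\<dots> \<le> expectation (\<lambda>\<omega>. \<bar>indicator (A \<alpha>) \<omega> * u ^ (W \<omega> - 1) - indicator (A \<alpha>) \<omega> * u ^ V \<omega>\<bar>)"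
        by (rule integral_abs_bound)
      also have "\<dots> \<le> expectation (\<lambda>\<omega>. \<Sum>\<beta>\<in>N-{\<alpha>}. indicator (A \<alpha> \<inter> A \<beta>) \<omega>)"
      proof (rule integral_mono)
        show "integrable M (\<lambda>\<omega>. \<Sum>\<beta>\<in>N-{\<alpha>}. indicator (A \<alpha> \<inter> A \<beta>) \<omega> :: real)"
          by (auto intro!: Bochner_Integration.integrable_sum simp: emeasure_eq_measure)
        fix \<omega>
        show "\<bar>indicator (A \<alpha>) \<omega> * u ^ (W \<omega> - 1) - indicator (A \<alpha>) \<omega> * u ^ V \<omega>\<bar>
          \<le> (\<Sum>\<beta>\<in>N-{\<alpha>}. indicator (A \<alpha> \<inter> A \<beta>) \<omega>)"
        proof (cases "\<omega> \<in> A \<alpha>")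
          case True
          have "\<alpha> \<in> {\<beta> \<in> N. \<omega> \<in> A \<beta>}" using \<alpha>N True by auto
          then have "1 \<le> card {\<beta> \<in> N. \<omega> \<in> A \<beta>}" using finN by (auto simp: Suc_le_eq card_gt_0_iff)
          then have "W \<omega> - 1 = V \<omega> + (card {\<beta> \<in> N. \<omega> \<in> A \<beta>} - 1)" unfolding WV by simp
          then show ?thesis
            using power_diff_le[OF u, of "V \<omega>" "card {\<beta> \<in> N. \<omega> \<in> A \<beta>} - 1"] True Nsum'[OF True]
            by (simp add: indicator_inter_arith)
        qed (auto simp: sum_nonneg)
      qed (use ints in auto)
      also have "\<dots> = (\<Sum>\<beta>\<in>N-{\<alpha>}. prob (A \<alpha> \<inter> A \<beta>))"
        by (subst Bochner_Integration.integral_sum) (auto simp: emeasure_eq_measure)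
      also have "\<dots> \<le> (\<Sum>\<beta>\<in>N-{\<alpha>}. q)"
        using \<alpha> by (intro sum_mono q) (auto simp: N_def)
      also have "\<dots> \<le> real m * q"
        using card finN \<open>0 \<le> q\<close> card_mono[of N "N - {\<alpha>}"] by (auto intro!: mult_right_mono)
      finally have 1: "\<bar>expectation (\<lambda>\<omega>. indicator (A \<alpha>) \<omega> * u ^ (W \<omega> - 1)) - p * expectation (\<lambda>\<omega>. u ^ V \<omega>)\<bar> \<le> real m * q"
        using indep[OF \<alpha>, of u] p[OF \<alpha>] by (simp add: V_def)
      have "\<bar>expectation (\<lambda>\<omega>. u ^ V \<omega>) - \<phi> u\<bar> = \<bar>expectation (\<lambda>\<omega>. u ^ V \<omega> - u ^ W \<omega>)\<bar>"
        unfolding \<phi>_def using ints by simp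
      also have "\<dots> \<le> expectation (\<lambda>\<omega>. \<bar>u ^ V \<omega> - u ^ W \<omega>\<bar>)"
        by (rule integral_abs_bound)
      also have "\<dots> \<le> expectation (\<lambda>\<omega>. \<Sum>\<beta>\<in>N. indicator (A \<beta>) \<omega>)"
      proof (rule integral_mono)
        show "integrable M (\<lambda>\<omega>. \<Sum>\<beta>\<in>N. indicator (A \<beta>) \<omega> :: real)"
          by (auto intro!: Bochner_Integration.integrable_sum simp: emeasure_eq_measure)
        show "\<bar>u ^ V \<omega> - u ^ W \<omega>\<bar> \<le> (\<Sum>\<beta>\<in>N. indicator (A \<beta>) \<omega>)" for \<omega>
          unfolding WV Nsum[symmetric] using power_diff_le[OF u, of "V \<omega>"] by (subst abs_minus_commute)
      qed (use ints in auto)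
      also have "\<dots> = (\<Sum>\<beta>\<in>N. prob (A \<beta>))"
        by (subst Bochner_Integration.integral_sum) (auto simp: emeasure_eq_measure)
      also have "\<dots> = real (card N) * p" using p by (simp add: N_def)
      also have "\<dots> \<le> real m * p" using card p0 by (intro mult_right_mono)
      finally have "p * \<bar>expectation (\<lambda>\<omega>. u ^ V \<omega>) - \<phi> u\<bar> \<le> p * (real m * p)"
        using p0 by (rule mult_left_mono)
      then have 2: "\<bar>p * expectation (\<lambda>\<omega>. u ^ V \<omega>) - p * \<phi> u\<bar> \<le> real m * p\<^sup>2"
        using p0 by (simp add: abs_mult right_diff_distrib[symmetric] power2_eq_square mult_ac)
      show ?thesis using 1 2 by linarith
    qed
    have "\<phi>' u = expectation (\<lambda>\<omega>. \<Sum>\<alpha>\<in>S. indicator (A \<alpha>) \<omega> * u ^ (W \<omega> - 1))"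
      unfolding \<phi>'_def sum_distrib_right[symmetric]
      by (intro Bochner_Integration.integral_cong refl arg_cong2[where f="(*)"])
         (auto simp: W_def W_sum indicator_def of_bool_def intro!: sum.cong)
    also have "\<dots> = (\<Sum>\<alpha>\<in>S. expectation (\<lambda>\<omega>. indicator (A \<alpha>) \<omega> * u ^ (W \<omega> - 1)))"
    proof (rule Bochner_Integration.integral_sum)
      fix \<alpha> assume [measurable]: "\<alpha> \<in> S"
      note Wm[measurable]
      show "integrable M (\<lambda>\<omega>. indicator (A \<alpha>) \<omega> * u ^ (W \<omega> - 1))"
        using pw by (auto intro!: integrable_const_bound[where B=1] simp: indicator_def)
    qed
    finally have "\<phi>' u - real (card S) * p * \<phi> u
        = (\<Sum>\<alpha>\<in>S. expectation (\<lambda>\<omega>. indicator (A \<alpha>) \<omega> * u ^ (W \<omega> - 1)) - p * \<phi> u)"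
      by (simp add: sum_subtractf)
    also have "\<bar>\<dots>\<bar> \<le> (\<Sum>\<alpha>\<in>S. real m * q + real m * p\<^sup>2)"
      by (rule order_trans[OF sum_abs sum_mono]) (rule single)
    finally show ?thesis by simp
  qed
  moreover have "\<phi> 1 = 1" by (simp add: \<phi>_def prob_space)
  \<comment> \<open>The sign of \<open>p\<close> is known only through a member of \<open>S\<close>;
    for empty \<open>S\<close> the product is 0.\<close>
  moreover have "0 \<le> real (card S) * p"
  proof (cases "S = {}")
    case False
    then obtain \<alpha> where "\<alpha> \<in> S" by auto
    then show ?thesis using p[of \<alpha>] measure_nonneg[of M "A \<alpha>"] by simp
  qed simp
  ultimately have "\<bar>\<phi> 0 - exp (- (real (card S) * p))\<bar> \<le> real (card S) * (real m * q + real m * p\<^sup>2)"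
    by (intro approximate_exponential_ode)
  \<comment> \<open>Since \<open>0 ^ 0 = 1\<close>, the power \<open>0 ^ W\<close> is the indicator
    of \<open>W = 0\<close>.\<close>
  moreover have "\<phi> 0 = prob {\<omega> \<in> space M. \<forall>\<alpha>\<in>S. \<omega> \<notin> A \<alpha>}"
  proof -
    have "\<phi> 0 = expectation (indicator {\<omega> \<in> space M. \<forall>\<alpha>\<in>S. \<omega> \<notin> A \<alpha>})"
      unfolding \<phi>_def
      by (intro Bochner_Integration.integral_cong) (auto simp: W_def fin indicator_def power_0_left)
    also have "\<dots> = prob ({\<omega> \<in> space M. \<forall>\<alpha>\<in>S. \<omega> \<notin> A \<alpha>} \<inter> space M)" by simp
    finally show ?thesis by (simp add: Int_def conj_commute)
  qed
  ultimately show ?thesis by simp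
qed

text \<open>Events indexed by two-element index sets are independent of those with disjoint index
  sets. If two of them share one index, then, given the first, the second asks a fresh point to fall
  into the section of \<open>D\<close> at the shared point; this gives \<open>p * b\<close>. A
  neighbour of a given pair is determined by one of its two indices and one of \<open>n\<close>
  partners, whence \<open>2 * n\<close>.\<close>

lemma (in prob_space) iid_pairs_void_probability:
  fixes X :: "nat \<Rightarrow> 'a \<Rightarrow> 'b" and b :: real
  assumes ind: "indep_vars (\<lambda>_. N) X {1..}"
    and distr: "\<And>i. 1 \<le> i \<Longrightarrow> distr M N (X i) = \<mu>"
    and D[measurable]: "D \<in> sets (N \<Otimes>\<^sub>M N)" and sym: "\<And>x y. (x, y) \<in> D \<Longrightarrow> (y, x) \<in> D"
    and b: "\<And>x. x \<in> space N \<Longrightarrow> measure \<mu> {y \<in> space N. (x, y) \<in> D} \<le> b" and "0 \<le> b"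
  defines "p \<equiv> measure (\<mu> \<Otimes>\<^sub>M \<mu>) D"
  shows "\<bar>prob {\<omega> \<in> space M. \<forall>i j. 1 \<le> i \<and> i < j \<and> j \<le> n \<longrightarrow> (X i \<omega>, X j \<omega>) \<notin> D}
      - exp (- (real (n choose 2) * p))\<bar> \<le> real (n choose 2) * (real (2 * n) * (p * b) + real (2 * n) * p\<^sup>2)"
proof -
  have X[measurable]: "X i \<in> measurable M N" if "1 \<le> i" for i
    using ind that by (auto simp: indep_vars_def)
  have sets_\<mu>[measurable_cong]: "sets \<mu> = sets N" using distr[of 1] by auto
  have space_\<mu>: "space \<mu> = space N" using sets_\<mu> by (rule sets_eq_imp_space_eq)
  interpret \<mu>: prob_space \<mu> using prob_space_distr[OF X[of 1]] distr[of 1] by simp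
  interpret \<mu>\<mu>: pair_prob_space \<mu> \<mu> ..
  interpret \<mu>\<mu>\<mu>: pair_prob_space "\<mu> \<Otimes>\<^sub>M \<mu>" \<mu> ..
  \<comment> \<open>Indexing by sets makes "sharing a point" a plain intersection. Both orders of
    the two indices are required, which by \<open>sym\<close> amounts to either one.\<close>
  define A where "A \<alpha> = {\<omega> \<in> space M. \<forall>i\<in>\<alpha>. \<forall>j\<in>\<alpha>. i \<noteq> j \<longrightarrow> (X i \<omega>, X j \<omega>) \<in> D}" for \<alpha>
  define S where "S = {\<alpha>. \<alpha> \<subseteq> {1..n} \<and> card \<alpha> = 2}"
  define nb where "nb \<alpha> = {\<beta>. \<beta> \<inter> \<alpha> \<noteq> {}}" for \<alpha> :: "nat set"
  have finS: "finite S" unfolding S_def by (rule finite_subset[of _ "Pow {1..n}"]) auto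
  have cardS: "card S = n choose 2" unfolding S_def using n_subsets[of "{1..n}" 2] by simp
  have SE: "\<exists>i j. i \<noteq> j \<and> 1 \<le> i \<and> i \<le> n \<and> 1 \<le> j \<and> j \<le> n \<and> \<alpha> = {i, j}" if "\<alpha> \<in> S" for \<alpha>
  proof -
    from that obtain i j where "\<alpha> = {i, j}" "i \<noteq> j" "\<alpha> \<subseteq> {1..n}"
      unfolding S_def by (auto simp: card_2_iff)
    then show ?thesis by (intro exI[of _ i] exI[of _ j]) auto
  qed
  have A_pair: "A {i, j} = {\<omega> \<in> space M. (X i \<omega>, X j \<omega>) \<in> D}" if "i \<noteq> j" for i j
    using that sym by (auto simp: A_def)
  have indep2: "indep_var (PiM K (\<lambda>_. N)) (\<lambda>\<omega>. restrict (\<lambda>i. X i \<omega>) K) (PiM L (\<lambda>_. N)) (\<lambda>\<omega>. restrict (\<lambda>i. X i \<omega>) L)"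
    if "K \<inter> L = {}" "K \<subseteq> {1..}" "L \<subseteq> {1..}" for K L
    using indep_var_restrict[OF ind that] .
  have joint2: "distr M (N \<Otimes>\<^sub>M N) (\<lambda>\<omega>. (X i \<omega>, X j \<omega>)) = \<mu> \<Otimes>\<^sub>M \<mu>" if "i \<noteq> j" "1 \<le> i" "1 \<le> j" for i j
  proof -
    have "indep_var N ((\<lambda>f. f i) \<circ> (\<lambda>\<omega>. restrict (\<lambda>k. X k \<omega>) {i})) N ((\<lambda>f. f j) \<circ> (\<lambda>\<omega>. restrict (\<lambda>k. X k \<omega>) {j}))"
      using that by (intro indep_var_compose[OF indep2]) auto
    then have "indep_var N (X i) N (X j)" by (simp add: comp_def)
    then show ?thesis using distr that by (subst (asm) indep_var_distribution_eq) auto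
  qed
  \<comment> \<open>\<open>indep_var\<close> asks both variables to take values in one type, so the
    third point is doubled to match the pair.\<close>
  have joint3: "distr M ((N \<Otimes>\<^sub>M N) \<Otimes>\<^sub>M (N \<Otimes>\<^sub>M N)) (\<lambda>\<omega>. ((X i \<omega>, X j \<omega>), (X k \<omega>, X k \<omega>)))
      = (\<mu> \<Otimes>\<^sub>M \<mu>) \<Otimes>\<^sub>M distr M (N \<Otimes>\<^sub>M N) (\<lambda>\<omega>. (X k \<omega>, X k \<omega>))"
    if "i \<noteq> j" "i \<noteq> k" "j \<noteq> k" "1 \<le> i" "1 \<le> j" "1 \<le> k" for i j k
  proof -
    have "indep_var (N \<Otimes>\<^sub>M N) ((\<lambda>f. (f i, f j)) \<circ> (\<lambda>\<omega>. restrict (\<lambda>k. X k \<omega>) {i, j}))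
      (N \<Otimes>\<^sub>M N) ((\<lambda>f. (f k, f k)) \<circ> (\<lambda>\<omega>. restrict (\<lambda>k. X k \<omega>) {k}))"
      using that by (intro indep_var_compose[OF indep2]) auto
    then have "indep_var (N \<Otimes>\<^sub>M N) (\<lambda>\<omega>. (X i \<omega>, X j \<omega>)) (N \<Otimes>\<^sub>M N) (\<lambda>\<omega>. (X k \<omega>, X k \<omega>))" by (simp add: comp_def)
    then show ?thesis using joint2 that by (subst (asm) indep_var_distribution_eq) auto
  qed
  have Am: "A \<alpha> \<in> events" if "\<alpha> \<in> S" for \<alpha>
  proof -
    from SE[OF that] obtain i j where "i \<noteq> j" "1 \<le> i" "1 \<le> j" "\<alpha> = {i, j}" by auto
    then show ?thesis using A_pair[of i j] by simp
  qed
  have pA: "prob (A \<alpha>) = p" if "\<alpha> \<in> S" for \<alpha>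
  proof -
    from SE[OF that] obtain i j where ij: "i \<noteq> j" "1 \<le> i" "1 \<le> j" "\<alpha> = {i, j}" by auto
    have "p = measure (distr M (N \<Otimes>\<^sub>M N) (\<lambda>\<omega>. (X i \<omega>, X j \<omega>))) D"
      using joint2 ij by (simp add: p_def)
    also have "\<dots> = prob (A \<alpha>)"
      using ij by (subst measure_distr) (auto simp: A_pair vimage_def Int_def conj_commute)
    finally show ?thesis ..
  qed
  have qA: "prob (A \<alpha> \<inter> A \<beta>) \<le> p * b" if "\<alpha> \<in> S" "\<beta> \<in> S" "\<beta> \<in> nb \<alpha>" "\<beta> \<noteq> \<alpha>" for \<alpha> \<beta>
  proof -
    obtain i j where ij: "i \<noteq> j" "1 \<le> i" "1 \<le> j" "\<alpha> = {i, j}" using SE[OF \<open>\<alpha> \<in> S\<close>] by auto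
    obtain i' j' where ij': "i' \<noteq> j'" "1 \<le> i'" "1 \<le> j'" "\<beta> = {i', j'}" using SE[OF \<open>\<beta> \<in> S\<close>] by auto
    obtain c d e where cde: "c \<noteq> d" "c \<noteq> e" "d \<noteq> e" "1 \<le> c" "1 \<le> d" "1 \<le> e" "\<alpha> = {c, d}" "\<beta> = {c, e}"
    proof -
      consider (1) "i = i'" | (2) "i = j'" | (3) "j = i'" | (4) "j = j'"
        using \<open>\<beta> \<in> nb \<alpha>\<close> ij ij' by (auto simp: nb_def)
      then show ?thesis
      proof cases
        case 1
        then have "j \<noteq> j'" using ij ij' \<open>\<beta> \<noteq> \<alpha>\<close> by auto
        with 1 show ?thesis using ij ij' by (intro that[of i j j']) auto
      next
        case 2
        then have "j \<noteq> i'" using ij ij' \<open>\<beta> \<noteq> \<alpha>\<close> by auto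
        with 2 show ?thesis using ij ij' by (intro that[of i j i']) auto
      next
        case 3
        then have "i \<noteq> j'" using ij ij' \<open>\<beta> \<noteq> \<alpha>\<close> by auto
        with 3 show ?thesis using ij ij' by (intro that[of j i j']) auto
      next
        case 4
        then have "i \<noteq> i'" using ij ij' \<open>\<beta> \<noteq> \<alpha>\<close> by auto
        with 4 show ?thesis using ij ij' by (intro that[of j i i']) auto
      qed
    qed
    \<comment> \<open>Both pairs are far; only one copy of the doubled third point is read.\<close>
    define C where "C = {z \<in> space ((N \<Otimes>\<^sub>M N) \<Otimes>\<^sub>M (N \<Otimes>\<^sub>M N)). fst z \<in> D \<and> (fst (fst z), fst (snd z)) \<in> D}"
    define \<nu> where "\<nu> = distr M (N \<Otimes>\<^sub>M N) (\<lambda>\<omega>. (X e \<omega>, X e \<omega>))"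
    note Xm = X[OF cde(4)] X[OF cde(5)] X[OF cde(6)]
    note Xsp = Xm[THEN measurable_space]
    interpret \<nu>: prob_space \<nu> unfolding \<nu>_def using Xm by (auto intro!: prob_space_distr measurable_Pair)
    have Cm: "C \<in> sets ((N \<Otimes>\<^sub>M N) \<Otimes>\<^sub>M (N \<Otimes>\<^sub>M N))" unfolding C_def by measurable
    have Cm': "C \<in> sets ((\<mu> \<Otimes>\<^sub>M \<mu>) \<Otimes>\<^sub>M \<nu>)"
      using Cm by (simp add: sets_\<mu> \<nu>_def cong: sets_pair_measure_cong)
    have Dm': "D \<in> sets (\<mu> \<Otimes>\<^sub>M \<mu>)" using D by (simp add: sets_\<mu> cong: sets_pair_measure_cong)
    have "emeasure M (A \<alpha> \<inter> A \<beta>)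
      = emeasure (distr M ((N \<Otimes>\<^sub>M N) \<Otimes>\<^sub>M (N \<Otimes>\<^sub>M N)) (\<lambda>\<omega>. ((X c \<omega>, X d \<omega>), (X e \<omega>, X e \<omega>)))) C"
      using cde Cm Xm by (subst emeasure_distr)
        (auto simp: A_pair C_def space_pair_measure intro!: arg_cong[where f="emeasure M"]
          Xsp)
    also have "\<dots> = emeasure ((\<mu> \<Otimes>\<^sub>M \<mu>) \<Otimes>\<^sub>M \<nu>) C" using joint3 cde by (simp add: \<nu>_def)
    also have "\<dots> = (\<integral>\<^sup>+w. emeasure \<nu> (Pair w -` C) \<partial>(\<mu> \<Otimes>\<^sub>M \<mu>))"
      by (rule \<nu>.emeasure_pair_measure_alt[OF Cm'])
    \<comment> \<open>The fibre over \<open>w\<close> is empty unless \<open>w\<close> lies in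
      \<open>D\<close>; then it is the section of \<open>D\<close> at the shared point
      \<open>fst w\<close>, of measure at most \<open>b\<close>.\<close>
    also have "\<dots> \<le> (\<integral>\<^sup>+w. ennreal b * indicator D w \<partial>(\<mu> \<Otimes>\<^sub>M \<mu>))"
    proof (rule nn_integral_mono)
      fix w assume w: "w \<in> space (\<mu> \<Otimes>\<^sub>M \<mu>)"
      show "emeasure \<nu> (Pair w -` C) \<le> ennreal b * indicator D w"
      proof (cases "w \<in> D")
        case True
        have w1: "fst w \<in> space N" using w by (auto simp: space_pair_measure space_\<mu>)
        have [measurable]: "Pair w -` C \<in> sets (N \<Otimes>\<^sub>M N)" using Cm by (rule sets_Pair1)
        have [measurable]: "{y \<in> space N. (fst w, y) \<in> D} \<in> sets N" using w1 by measurable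
        have "emeasure \<nu> (Pair w -` C) = emeasure M ((\<lambda>\<omega>. (X e \<omega>, X e \<omega>)) -` (Pair w -` C) \<inter> space M)"
          unfolding \<nu>_def using Xm by (subst emeasure_distr) (auto intro!: measurable_Pair)
        also have "\<dots> = emeasure M (X e -` {y \<in> space N. (fst w, y) \<in> D} \<inter> space M)"
          using True w Xm by (intro arg_cong[where f="emeasure M"])
            (auto simp: C_def space_pair_measure space_\<mu> Xsp)
        also have "\<dots> = emeasure \<mu> {y \<in> space N. (fst w, y) \<in> D}"
          unfolding distr[OF cde(6), symmetric] using Xm by (intro emeasure_distr[symmetric]) auto
        finally show ?thesis
          using True w b[of "fst w"]
          by (auto simp: \<mu>.emeasure_eq_measure space_pair_measure space_\<mu> intro!: ennreal_leI)
      next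
        case False
        then have "Pair w -` C = {}" by (auto simp: C_def)
        then show ?thesis by simp
      qed
    qed
    also have "\<dots> = ennreal (b * p)"
      unfolding p_def using \<open>0 \<le> b\<close> Dm'
      by (subst nn_integral_cmult) (auto simp: \<mu>\<mu>.emeasure_eq_measure ennreal_mult)
    finally show ?thesis
      using \<open>0 \<le> b\<close> by (simp add: emeasure_eq_measure mult.commute p_def)
  qed
  have m: "card (S \<inter> nb \<alpha>) \<le> 2 * n" if "\<alpha> \<in> S" for \<alpha>
  proof -
    obtain i j where ij: "i \<noteq> j" "1 \<le> i" "1 \<le> j" "\<alpha> = {i, j}" using SE[OF \<open>\<alpha> \<in> S\<close>] by auto
    have "S \<inter> nb \<alpha> \<subseteq> (\<lambda>(k, l). {k, l}) ` (\<alpha> \<times> {1..n})"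
    proof
      fix \<beta> assume \<beta>: "\<beta> \<in> S \<inter> nb \<alpha>"
      then obtain k l where kl: "1 \<le> k" "k \<le> n" "1 \<le> l" "l \<le> n" "\<beta> = {k, l}" using SE by blast
      then have "k \<in> \<alpha> \<or> l \<in> \<alpha>" using \<beta> by (auto simp: nb_def)
      then show "\<beta> \<in> (\<lambda>(k, l). {k, l}) ` (\<alpha> \<times> {1..n})"
      proof
        assume "l \<in> \<alpha>"
        then show ?thesis using kl by (intro image_eqI[where x="(l, k)"]) auto
      qed (use kl in \<open>auto intro!: image_eqI[where x="(k, l)"]\<close>)
    qed
    then have "card (S \<inter> nb \<alpha>) \<le> card (\<alpha> \<times> {1..n})"
      using ij by (intro surj_card_le) auto
    also have "\<dots> = 2 * n" using ij by (simp add: card_cartesian_product)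
    finally show ?thesis .
  qed
  have indep: "expectation (\<lambda>\<omega>. indicator (A \<alpha>) \<omega> * u ^ card {\<beta> \<in> S - nb \<alpha>. \<omega> \<in> A \<beta>})
      = prob (A \<alpha>) * expectation (\<lambda>\<omega>. u ^ card {\<beta> \<in> S - nb \<alpha>. \<omega> \<in> A \<beta>})" if "\<alpha> \<in> S" for \<alpha> and u :: real
  proof -
    \<comment> \<open>Events whose pair avoids \<alpha> read only points with index in
      \<open>J\<close>. The two factors are thus functions of disjoint coordinate blocks, and their
      product has the product expectation.\<close>
    define J where "J = {1..n} - \<alpha>"
    define Q where "Q \<beta> f \<longleftrightarrow> (\<forall>i\<in>\<beta>. \<forall>j\<in>\<beta>. i \<noteq> j \<longrightarrow> (f i, f j) \<in> D)" for \<beta> and f :: "nat \<Rightarrow> 'b"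
    define Y1 where "Y1 f = (of_bool (Q \<alpha> f) :: real)" for f
    define Y2 where "Y2 f = u ^ (\<Sum>\<beta>\<in>S - nb \<alpha>. of_bool (Q \<beta> f))" for f
    have \<alpha>: "finite \<alpha>" "\<alpha> \<subseteq> {1..}" using that by (auto simp: S_def card_2_iff)
    have \<beta>: "finite \<beta>" "\<beta> \<subseteq> J" if "\<beta> \<in> S - nb \<alpha>" for \<beta>
      using that by (auto simp: S_def nb_def J_def card_2_iff)
    have Qm: "Measurable.pred (PiM K (\<lambda>_. N)) (Q \<beta>)" if "finite \<beta>" "\<beta> \<subseteq> K" for \<beta> K
    proof -
      have "Measurable.pred (PiM K (\<lambda>_. N)) (\<lambda>f. (f i, f j) \<in> D)" if "i \<in> \<beta>" "j \<in> \<beta>" for i j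
      proof -
        have "i \<in> K" "j \<in> K" using that \<open>\<beta> \<subseteq> K\<close> by auto
        then show ?thesis by measurable
      qed
      then show ?thesis unfolding Q_def using \<open>finite \<beta>\<close> by measurable
    qed
    have Y1m: "Y1 \<in> borel_measurable (PiM \<alpha> (\<lambda>_. N))"
    proof -
      note Qm[OF \<alpha>(1) subset_refl, measurable]
      show ?thesis unfolding Y1_def by measurable
    qed
    have Y2m: "Y2 \<in> borel_measurable (PiM J (\<lambda>_. N))"
    proof -
      have [measurable]: "\<beta> \<in> S - nb \<alpha> \<Longrightarrow> Measurable.pred (PiM J (\<lambda>_. N)) (Q \<beta>)" for \<beta> 
        using \<beta> by (intro Qm)
      have "(\<lambda>f. \<Sum>\<beta>\<in>S - nb \<alpha>. of_bool (Q \<beta> f) :: nat) \<in> measurable (PiM J (\<lambda>_. N)) (count_space UNIV)"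
        by measurable
      then show ?thesis unfolding Y2_def by (rule measurable_compose) simp
    qed
    have iv: "indep_var borel (Y1 \<circ> (\<lambda>\<omega>. restrict (\<lambda>i. X i \<omega>) \<alpha>)) borel (Y2 \<circ> (\<lambda>\<omega>. restrict (\<lambda>i. X i \<omega>) J))"
      using \<alpha> Y1m Y2m by (intro indep_var_compose[OF indep2]) (auto simp: J_def)
    have e1: "(Y1 \<circ> (\<lambda>\<omega>. restrict (\<lambda>i. X i \<omega>) \<alpha>)) \<omega> = indicator (A \<alpha>) \<omega>" if "\<omega> \<in> space M" for \<omega>
      using that by (simp add: Y1_def Q_def A_def indicator_def)
    have e2: "(Y2 \<circ> (\<lambda>\<omega>. restrict (\<lambda>i. X i \<omega>) J)) \<omega> = u ^ card {\<beta> \<in> S - nb \<alpha>. \<omega> \<in> A \<beta>}" if "\<omega> \<in> space M" for \<omega>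
    proof -
      have "Q \<beta> (restrict (\<lambda>i. X i \<omega>) J) \<longleftrightarrow> \<omega> \<in> A \<beta>" if "\<beta> \<in> S - nb \<alpha>" for \<beta>
        using \<beta>(2)[OF that] \<open>\<omega> \<in> space M\<close> by (auto simp: Q_def A_def subset_eq)
      then have "(\<Sum>\<beta>\<in>S - nb \<alpha>. of_bool (Q \<beta> (restrict (\<lambda>i. X i \<omega>) J))) = (\<Sum>\<beta>\<in>S - nb \<alpha>. of_bool (\<omega> \<in> A \<beta>) :: nat)"
        by (intro sum.cong) auto
      also have "\<dots> = card {\<beta> \<in> S - nb \<alpha>. \<omega> \<in> A \<beta>}"
        using finS by (subst card_eq_sum, intro sum.mono_neutral_cong_right) auto
      finally show ?thesis by (simp add: Y2_def)
    qed
    \<comment> \<open>Here \<open>u\<close> is an arbitrary real, so integrability needs a bound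
      that also covers \<open>\<bar>u\<bar> > 1\<close>.\<close>
    have bound: "(1 + \<bar>u\<bar>) ^ card S \<ge> \<bar>u ^ card {\<beta> \<in> S - nb \<alpha>. \<omega> \<in> A \<beta>}\<bar>" for \<omega>
    proof -
      have "\<bar>u ^ card {\<beta> \<in> S - nb \<alpha>. \<omega> \<in> A \<beta>}\<bar> \<le> (1 + \<bar>u\<bar>) ^ card {\<beta> \<in> S - nb \<alpha>. \<omega> \<in> A \<beta>}"
        by (simp add: power_abs power_mono)
      also have "\<dots> \<le> (1 + \<bar>u\<bar>) ^ card S"
        using finS by (intro power_increasing card_mono) auto
      finally show ?thesis .
    qed
    have i1: "integrable M (Y1 \<circ> (\<lambda>\<omega>. restrict (\<lambda>i. X i \<omega>) \<alpha>))"
      using e1 indep_var_rv1[OF iv] by (intro integrable_const_bound[where B=1]) (auto simp: indicator_def)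
    have i2: "integrable M (Y2 \<circ> (\<lambda>\<omega>. restrict (\<lambda>i. X i \<omega>) J))"
      using e2 bound indep_var_rv2[OF iv] by (intro integrable_const_bound[where B="(1 + \<bar>u\<bar>) ^ card S"]) auto
    have "expectation (\<lambda>\<omega>. indicator (A \<alpha>) \<omega> * u ^ card {\<beta> \<in> S - nb \<alpha>. \<omega> \<in> A \<beta>})
      = expectation (\<lambda>\<omega>. (Y1 \<circ> (\<lambda>\<omega>. restrict (\<lambda>i. X i \<omega>) \<alpha>)) \<omega> * (Y2 \<circ> (\<lambda>\<omega>. restrict (\<lambda>i. X i \<omega>) J)) \<omega>)"
      using e1 e2 by (intro Bochner_Integration.integral_cong) auto
    also have "\<dots> = expectation (Y1 \<circ> (\<lambda>\<omega>. restrict (\<lambda>i. X i \<omega>) \<alpha>)) * expectation (Y2 \<circ> (\<lambda>\<omega>. restrict (\<lambda>i. X i \<omega>) J))"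
      by (rule indep_var_lebesgue_integral[OF iv i1 i2])
    also have "expectation (Y1 \<circ> (\<lambda>\<omega>. restrict (\<lambda>i. X i \<omega>) \<alpha>)) = expectation (indicator (A \<alpha>))"
      using e1 by (intro Bochner_Integration.integral_cong) auto
    also have "\<dots> = prob (A \<alpha>)" using Am[OF that] by simp
    also have "expectation (Y2 \<circ> (\<lambda>\<omega>. restrict (\<lambda>i. X i \<omega>) J)) = expectation (\<lambda>\<omega>. u ^ card {\<beta> \<in> S - nb \<alpha>. \<omega> \<in> A \<beta>})"
      using e2 by (intro Bochner_Integration.integral_cong) auto
    finally show ?thesis .
  qed
  have "\<bar>prob {\<omega> \<in> space M. \<forall>\<alpha>\<in>S. \<omega> \<notin> A \<alpha>} - exp (- (real (card S) * p))\<bar>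
    \<le> real (card S) * (real (2 * n) * (p * b) + real (2 * n) * p\<^sup>2)"
  proof (rule dissociated_void_probability[OF finS Am pA qA m _ _ indep])
    show "\<alpha> \<in> nb \<alpha>" if "\<alpha> \<in> S" for \<alpha> using SE[OF that] by (auto simp: nb_def)
    show "0 \<le> p * b" using \<open>0 \<le> b\<close> by (simp add: p_def)
  qed
  moreover have "{\<omega> \<in> space M. \<forall>\<alpha>\<in>S. \<omega> \<notin> A \<alpha>}
    = {\<omega> \<in> space M. \<forall>i j. 1 \<le> i \<and> i < j \<and> j \<le> n \<longrightarrow> (X i \<omega>, X j \<omega>) \<notin> D}" (is "?l = ?r")
  proof (intro equalityI subsetI)
    fix \<omega> assume "\<omega> \<in> ?l"
    then have \<omega>: "\<omega> \<in> space M" "\<And>\<alpha>. \<alpha> \<in> S \<Longrightarrow> \<omega> \<notin> A \<alpha>" by auto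
    have "(X i \<omega>, X j \<omega>) \<notin> D" if "1 \<le> i" "i < j" "j \<le> n" for i j
      using \<omega>(2)[of "{i, j}"] \<omega>(1) that A_pair[of i j] by (auto simp: S_def)
    with \<omega> show "\<omega> \<in> ?r" by auto
  next
    fix \<omega> assume \<omega>: "\<omega> \<in> ?r"
    have "\<omega> \<notin> A \<alpha>" if "\<alpha> \<in> S" for \<alpha>
    proof -
      obtain i j where ij: "i \<noteq> j" "1 \<le> i" "i \<le> n" "1 \<le> j" "j \<le> n" "\<alpha> = {i, j}" using SE[OF \<open>\<alpha> \<in> S\<close>] by auto
      then show ?thesis using \<omega> A_pair[of i j] sym[of "X i \<omega>" "X j \<omega>"]
        by (cases "i < j") auto
    qed
    with \<omega> show "\<omega> \<in> ?l" by auto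
  qed
  ultimately show ?thesis by (simp add: cardS)
qed

section \<open>Cylindrical coordinates and rotations\<close>

lemma borel_measurable_fst [measurable]:
  fixes f :: "'a \<Rightarrow> 'b::second_countable_topology \<times> 'c::second_countable_topology"
  shows "f \<in> borel_measurable M \<Longrightarrow> (\<lambda>x. fst (f x)) \<in> borel_measurable M"
  by (erule measurable_compose) (intro borel_measurable_continuous_onI continuous_intros)

lemma borel_measurable_snd [measurable]:
  fixes f :: "'a \<Rightarrow> 'b::second_countable_topology \<times> 'c::second_countable_topology"
  shows "f \<in> borel_measurable M \<Longrightarrow> (\<lambda>x. snd (f x)) \<in> borel_measurable M"
  by (erule measurable_compose) (intro borel_measurable_continuous_onI continuous_intros)

definition vec3 :: "real \<Rightarrow> real \<Rightarrow> real \<Rightarrow> real ^ 3" where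
  "vec3 x y z = x *\<^sub>R axis 1 1 + y *\<^sub>R axis 2 1 + z *\<^sub>R axis 3 1"

lemma vec3_nth [simp]: "vec3 x y z $ 1 = x" "vec3 x y z $ 2 = y" "vec3 x y z $ 3 = z"
  by (simp_all add: vec3_def axis_def)

lemma vec3_measurable [measurable]:
  "f \<in> borel_measurable M \<Longrightarrow> g \<in> borel_measurable M \<Longrightarrow> h \<in> borel_measurable M \<Longrightarrow>
    (\<lambda>w. vec3 (f w) (g w) (h w)) \<in> borel_measurable M"
  unfolding vec3_def by (intro borel_measurable_add borel_measurable_scaleR borel_measurable_const)

lemma measurable_nth [measurable]: "(\<lambda>x::real^'n. x $ i) \<in> borel_measurable borel"
  by (intro borel_measurable_continuous_onI continuous_intros)

lemma norm_vec_3: "norm (x :: real ^ 3) = sqrt ((x $ 1)\<^sup>2 + (x $ 2)\<^sup>2 + (x $ 3)\<^sup>2)"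
  by (simp add: norm_vec_def L2_set_def sum_3)

text \<open>Comparison on boxes. The nesting of the triple keeps the first two coordinates together
  as a point of the plane, ready for integration over horizontal discs.\<close>

lemma lborel_vec3: "distr lborel borel (\<lambda>q. vec3 (fst (fst q)) (snd (fst q)) (snd q)) = lborel"
proof (rule lborel_eqI[symmetric])
  fix l u :: "real ^ 3" assume le: "\<And>b. b \<in> Basis \<Longrightarrow> l \<bullet> b \<le> u \<bullet> b"
  have le': "l $ i \<le> u $ i" for i using le[of "axis i 1"] by (simp add: inner_axis)
  have "(\<lambda>q. vec3 (fst (fst q)) (snd (fst q)) (snd q)) -` box l u = ({l $ 1<..<u $ 1} \<times> {l $ 2<..<u $ 2}) \<times> {l $ 3<..<u $ 3}"
    by (auto simp: mem_box_cart forall_3)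
  then have "emeasure (distr lborel borel (\<lambda>q. vec3 (fst (fst q)) (snd (fst q)) (snd q))) (box l u)
      = emeasure ((lborel \<Otimes>\<^sub>M lborel) \<Otimes>\<^sub>M lborel) (({l $ 1<..<u $ 1} \<times> {l $ 2<..<u $ 2}) \<times> {l $ 3<..<u $ 3})"
    by (subst emeasure_distr) (simp_all add: lborel_prod)
  also have "\<dots> = ennreal (u $ 1 - l $ 1) * ennreal (u $ 2 - l $ 2) * ennreal (u $ 3 - l $ 3)"
    using le'[of 1] le'[of 2] le'[of 3] by (simp add: lborel.emeasure_pair_measure_Times)
  also have "\<dots> = ennreal ((u $ 1 - l $ 1) * (u $ 2 - l $ 2) * (u $ 3 - l $ 3))"
    using le'[of 1] le'[of 2] le'[of 3] by (simp add: ennreal_mult)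
  also have "(u $ 1 - l $ 1) * (u $ 2 - l $ 2) * (u $ 3 - l $ 3) = (\<Prod>b\<in>Basis. (u - l) \<bullet> b)"
  proof -
    have "(\<Prod>b\<in>Basis. (u - l) \<bullet> b) = (\<Prod>i\<in>UNIV. (u - l) \<bullet> axis i 1)"
      by (simp add: Basis_vec_def UNION_singleton_eq_range prod.reindex inj_on_def axis_eq_axis)
    also have "\<dots> = (u $ 1 - l $ 1) * (u $ 2 - l $ 2) * (u $ 3 - l $ 3)"
      unfolding UNIV_3 by (simp add: inner_axis mult.assoc)
    finally show ?thesis ..
  qed
  finally show "emeasure (distr lborel borel (\<lambda>q. vec3 (fst (fst q)) (snd (fst q)) (snd q))) (box l u) = (\<Prod>b\<in>Basis. (u - l) \<bullet> b)" .
qed simp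

lemma nn_integral_vec3:
  assumes [measurable]: "f \<in> borel_measurable borel"
  shows "(\<integral>\<^sup>+v. f v \<partial>lborel) = (\<integral>\<^sup>+p. \<integral>\<^sup>+z. f (vec3 (fst p) (snd p) z) \<partial>lborel \<partial>lborel)"
proof -
  have "(\<integral>\<^sup>+v. f v \<partial>lborel) = (\<integral>\<^sup>+v. f v \<partial>distr lborel borel (\<lambda>q. vec3 (fst (fst q)) (snd (fst q)) (snd q)))"
    unfolding lborel_vec3 ..
  also have "\<dots> = (\<integral>\<^sup>+q. f (vec3 (fst (fst q)) (snd (fst q)) (snd q)) \<partial>(lborel \<Otimes>\<^sub>M lborel))"
    unfolding lborel_prod by (rule nn_integral_distr) measurable
  also have "\<dots> = (\<integral>\<^sup>+p. \<integral>\<^sup>+z. f (vec3 (fst p) (snd p) z) \<partial>lborel \<partial>lborel)"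
    by (subst lborel.nn_integral_fst[symmetric]) (auto simp: case_prod_beta)
  finally show ?thesis .
qed

lemma nn_integral_lborel_pair:
  fixes f :: "'a::euclidean_space \<times> 'b::euclidean_space \<Rightarrow> ennreal"
  assumes "f \<in> borel_measurable borel"
  shows "(\<integral>\<^sup>+p. f p \<partial>lborel) = (\<integral>\<^sup>+x. \<integral>\<^sup>+y. f (x, y) \<partial>lborel \<partial>lborel)"
  using assms by (subst lborel_prod[symmetric], subst lborel.nn_integral_fst[symmetric]) (auto simp: lborel_prod)

lemma nn_integral_swap:
  fixes f :: "'a::euclidean_space \<Rightarrow> 'b::euclidean_space \<Rightarrow> ennreal"
  assumes "case_prod f \<in> borel_measurable borel"
  shows "(\<integral>\<^sup>+x. \<integral>\<^sup>+y. f x y \<partial>lborel \<partial>lborel) = (\<integral>\<^sup>+y. \<integral>\<^sup>+x. f x y \<partial>lborel \<partial>lborel)"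
  using assms by (intro lborel_pair.Fubini'[symmetric]) (simp add: lborel_prod)

text \<open>A disc of squared radius \<open>1 - x\<close> has area \<open>pi * (1 - x)\<close>,
  linear in \<open>x\<close>, so the image density is the constant \<open>pi\<close>. This takes the
  place of polar coordinates. The image measure is infinite, but upper rays have finite mass and
  determine it.\<close>

lemma distr_one_minus_norm_sq:
  "distr (lborel :: (real \<times> real) measure) borel (\<lambda>p. 1 - (fst p)\<^sup>2 - (snd p)\<^sup>2)
    = density lborel (\<lambda>s. ennreal pi * indicator {..1} s)" (is "?l = ?r")
proof (rule measure_eqI_lessThan)
  have l: "emeasure ?l {x<..} = ennreal (pi * max 0 (1 - x))" for x
  proof -
    have "emeasure ?l {x<..} = emeasure lborel {p :: real \<times> real. (fst p)\<^sup>2 + (snd p)\<^sup>2 < 1 - x}"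
      by (subst emeasure_distr) (auto intro!: arg_cong[where f="emeasure lborel"])
    also have "\<dots> = ennreal (pi * max 0 (1 - x))"
    proof (cases "x < 1")
      case True
      have "{p :: real \<times> real. (fst p)\<^sup>2 + (snd p)\<^sup>2 < 1 - x} = ball 0 (sqrt (1 - x))"
        by (auto simp: norm_prod_def)
      then show ?thesis using True
        by (simp add: emeasure_ball unit_ball_vol_2 max_def)
    next
      case False
      have "\<not> (fst p)\<^sup>2 + (snd p)\<^sup>2 < 1 - x" for p :: "real \<times> real"
        using False sum_power2_ge_zero[of "fst p" "snd p"] by linarith
      then show ?thesis using False by (simp add: max_def)
    qed
    finally show ?thesis .
  qed
  show "emeasure ?l {x<..} < \<infinity>" for x unfolding l by simp
  have r: "emeasure ?r {x<..} = ennreal (pi * max 0 (1 - x))" for x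
  proof -
    have "emeasure ?r {x<..} = (\<integral>\<^sup>+s. ennreal pi * indicator {x<..1} s \<partial>lborel)"
      by (subst emeasure_density) (auto intro!: nn_integral_cong simp: indicator_def)
    also have "\<dots> = ennreal pi * emeasure lborel {x<..1}" by (rule nn_integral_cmult_indicator) simp
    also have "\<dots> = ennreal (pi * max 0 (1 - x))"
      by (cases "x \<le> 1") (auto simp: ennreal_mult max_def)
    finally show ?thesis .
  qed
  show "emeasure ?l {x<..} = emeasure ?r {x<..}" for x unfolding l r ..
qed auto

lemma nn_integral_radial:
  assumes [measurable]: "g \<in> borel_measurable borel"
  shows "(\<integral>\<^sup>+p. g (1 - (fst p)\<^sup>2 - (snd p)\<^sup>2) \<partial>(lborel :: (real \<times> real) measure))
    = ennreal pi * (\<integral>\<^sup>+s. indicator {..1} s * g s \<partial>lborel)"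
proof -
  have "(\<integral>\<^sup>+p. g (1 - (fst p)\<^sup>2 - (snd p)\<^sup>2) \<partial>(lborel :: (real \<times> real) measure))
    = (\<integral>\<^sup>+s. g s \<partial>distr (lborel :: (real \<times> real) measure) borel (\<lambda>p. 1 - (fst p)\<^sup>2 - (snd p)\<^sup>2))"
    by (subst nn_integral_distr) auto
  also have "\<dots> = (\<integral>\<^sup>+s. ennreal pi * (indicator {..1} s * g s) \<partial>lborel)"
    unfolding distr_one_minus_norm_sq by (subst nn_integral_density) (auto simp: mult_ac)
  also have "\<dots> = ennreal pi * (\<integral>\<^sup>+s. indicator {..1} s * g s \<partial>lborel)"
    by (rule nn_integral_cmult) simp
  finally show ?thesis .
qed

lemma ellipsoid_sets [measurable]: "ellipsoid a \<in> sets borel"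
  unfolding ellipsoid_def by measurable

lemma ellipsoid_norm_le:
  assumes "0 < a" "a < 1" "x \<in> ellipsoid a" shows "norm x \<le> 1"
proof -
  have "(x $ 3)\<^sup>2 * 1 \<le> (x $ 3)\<^sup>2 * (1 / a\<^sup>2)"
    using assms by (intro mult_left_mono) (auto simp: power_le_one)
  then show ?thesis using assms by (auto simp: norm_vec_3 ellipsoid_def)
qed

section \<open>Rotation invariance about the third axis\<close>

definition far_set :: "real \<Rightarrow> real \<Rightarrow> real ^ 3 \<Rightarrow> (real ^ 3) set" where
  "far_set a \<epsilon> x = {y \<in> ellipsoid a. 2 - \<epsilon> \<le> norm (x - y)}"

lemma far_set_sets [measurable]: "far_set a \<epsilon> x \<in> sets borel"
  unfolding far_set_def by measurable

text \<open>A rotation about the third axis preserves the ellipsoid, distances and volume, and can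
  bring \<open>x\<close> into the half-plane of vanishing second and nonnegative first
  coordinate.\<close>

lemma emeasure_far_set_rotate:
  assumes a: "0 < a" "a < 1"
  shows "emeasure lborel (far_set a \<epsilon> x)
    = emeasure lborel (far_set a \<epsilon> (vec3 (sqrt ((x $ 1)\<^sup>2 + (x $ 2)\<^sup>2)) 0 (x $ 3)))"
proof (cases "x $ 1 = 0 \<and> x $ 2 = 0")
  case True
  then have "vec3 (sqrt ((x $ 1)\<^sup>2 + (x $ 2)\<^sup>2)) 0 (x $ 3) = x" by (simp add: vec_eq_iff forall_3)
  then show ?thesis by (simp only:)
next
  case False
  define r where "r = sqrt ((x $ 1)\<^sup>2 + (x $ 2)\<^sup>2)"
  \<comment> \<open>\<open>c\<close> and \<open>d\<close> are the cosine and sine of the azimuth of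
    \<open>x\<close>, which exists off the axis only.\<close>
  define c where "c = x $ 1 / r"
  define d where "d = x $ 2 / r"
  have r: "0 < r" "r\<^sup>2 = (x $ 1)\<^sup>2 + (x $ 2)\<^sup>2"
    using False by (simp_all add: r_def sum_power2_gt_zero_iff)
  have cd: "c\<^sup>2 + d\<^sup>2 = 1" 
    unfolding c_def d_def power_divide add_divide_distrib[symmetric] r(2)[symmetric] using r(1) by simp
  have cx: "c * x $ 1 + d * x $ 2 = r" "c * x $ 2 - d * x $ 1 = 0"
  proof -
    have "c * x $ 1 + d * x $ 2 = r\<^sup>2 / r"
      unfolding r(2) by (simp add: c_def d_def power2_eq_square add_divide_distrib)
    then show "c * x $ 1 + d * x $ 2 = r" using r(1) by (simp add: power2_eq_square)
  qed (simp add: c_def d_def)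
  define R where "R y = vec3 (c * y $ 1 + d * y $ 2) (c * y $ 2 - d * y $ 1) (y $ 3)" for y :: "real ^ 3"
  have linR: "linear R"
    by (rule linearI) (auto simp: R_def vec_eq_iff forall_3 algebra_simps)
  have sq: "(c * u + d * v)\<^sup>2 + (c * v - d * u)\<^sup>2 = u\<^sup>2 + v\<^sup>2" for u v
  proof -
    have "(c * u + d * v)\<^sup>2 + (c * v - d * u)\<^sup>2 = (c\<^sup>2 + d\<^sup>2) * (u\<^sup>2 + v\<^sup>2)"
      by (simp add: power2_eq_square algebra_simps)
    then show ?thesis by (simp add: cd)
  qed
  have normR: "norm (R y) = norm y" for y by (simp add: norm_vec_3 R_def sq)
  have R: "orthogonal_transformation R"
    using linR normR by (simp add: orthogonal_transformation)
  have Rx: "R x = vec3 r 0 (x $ 3)" using cx by (simp add: R_def)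
  have E: "R y \<in> ellipsoid a \<longleftrightarrow> y \<in> ellipsoid a" for y
    by (simp add: ellipsoid_def R_def sq)
  have mem: "R y \<in> far_set a \<epsilon> (R x) \<longleftrightarrow> y \<in> far_set a \<epsilon> x" for y
    using normR[of "x - y"] linear_diff[OF linR, of x y] by (simp add: far_set_def E)
  have img: "R ` far_set a \<epsilon> x = far_set a \<epsilon> (R x)"
  proof (intro equalityI subsetI)
    fix z assume "z \<in> far_set a \<epsilon> (R x)"
    moreover obtain y where "z = R y" using orthogonal_transformation_surj[OF R] by (rule surjE)
    ultimately show "z \<in> R ` far_set a \<epsilon> x" using mem by auto
  qed (use mem in auto)
  \<comment> \<open>Invariance of volume is applied to sets of finite Lebesgue measure; the unit
    ball contains all of these. Being Borel, they have the same measure under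
    \<open>lborel\<close>.\<close>
  have bdd: "far_set a \<epsilon> v \<in> lmeasurable" for v
  proof (rule bounded_set_imp_lmeasurable)
    show "bounded (far_set a \<epsilon> v)"
      by (rule bounded_subset[OF bounded_cball[of 0 1]]) (auto simp: far_set_def ellipsoid_norm_le[OF a])
    show "far_set a \<epsilon> v \<in> sets lebesgue"
      by (intro sets_completionI_sets) simp
  qed
  have em: "emeasure lborel (far_set a \<epsilon> v) = ennreal (measure lebesgue (far_set a \<epsilon> v))" for v
  proof -
    have "emeasure lborel (far_set a \<epsilon> v) = emeasure lebesgue (far_set a \<epsilon> v)"
      by (subst emeasure_completion) (simp_all add: main_part_sets)
    then show ?thesis using emeasure_eq_measure2[OF bdd[of v]] by simp
  qed
  show ?thesis
    unfolding em using measure_orthogonal_image[OF R bdd, of x] by (simp only: img Rx r_def)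
qed

section \<open>Scaling near an antipodal pair of equatorial points\<close>

lemma nn_integral_lborel_5:
  fixes f :: "real \<times> real \<times> real \<times> real \<times> real \<Rightarrow> ennreal"
  assumes [measurable]: "f \<in> borel_measurable borel"
  shows "(\<integral>\<^sup>+p. f p \<partial>lborel) = (\<integral>\<^sup>+x1. \<integral>\<^sup>+x2. \<integral>\<^sup>+x3. \<integral>\<^sup>+x4. \<integral>\<^sup>+x5. f (x1, x2, x3, x4, x5)
    \<partial>lborel \<partial>lborel \<partial>lborel \<partial>lborel \<partial>lborel)"
proof -
  have "(\<integral>\<^sup>+p. f p \<partial>lborel) = (\<integral>\<^sup>+x1. \<integral>\<^sup>+p. f (x1, p) \<partial>lborel \<partial>lborel)"
    by (rule nn_integral_lborel_pair) fact
  also have "\<dots> = (\<integral>\<^sup>+x1. \<integral>\<^sup>+x2. \<integral>\<^sup>+p. f (x1, x2, p) \<partial>lborel \<partial>lborel \<partial>lborel)"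
    by (intro nn_integral_cong nn_integral_lborel_pair) measurable
  also have "\<dots> = (\<integral>\<^sup>+x1. \<integral>\<^sup>+x2. \<integral>\<^sup>+x3. \<integral>\<^sup>+p. f (x1, x2, x3, p) \<partial>lborel \<partial>lborel \<partial>lborel \<partial>lborel)"
    by (intro nn_integral_cong nn_integral_lborel_pair) measurable
  also have "\<dots> = (\<integral>\<^sup>+x1. \<integral>\<^sup>+x2. \<integral>\<^sup>+x3. \<integral>\<^sup>+x4. \<integral>\<^sup>+x5. f (x1, x2, x3, x4, x5)
      \<partial>lborel \<partial>lborel \<partial>lborel \<partial>lborel \<partial>lborel)"
    by (intro nn_integral_cong nn_integral_lborel_pair) measurable
  finally show ?thesis .
qed

text \<open>Far pairs in scaled coordinates. The first two conditions place the first point in the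
  ellipsoid, the third is the ellipsoid inequality of the second point after cancelling \<epsilon>,
  and the last compares squared distances. The order of the components is the order of integration:
  first point outside, second point inside.\<close>

definition near_set :: "real \<Rightarrow> real \<Rightarrow> (real \<times> real \<times> real \<times> real \<times> real) set" where
  "near_set a \<epsilon> = {(y, s, w, \<tau>, y'). y\<^sup>2 \<le> s \<and> \<epsilon> * s \<le> 1 \<and> \<epsilon> * w\<^sup>2 / 4 + \<tau>\<^sup>2 + y'\<^sup>2 \<le> w \<and>
    (2 - \<epsilon>)\<^sup>2 \<le> (sqrt (1 - \<epsilon> * s) + 1 - \<epsilon> * w / 2)\<^sup>2 + \<epsilon> * \<tau>\<^sup>2 + a\<^sup>2 * \<epsilon> * (y - y')\<^sup>2}"

lemma near_set_sets [measurable]: "near_set a \<epsilon> \<in> sets borel"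
  unfolding near_set_def case_prod_beta
  by (intro borel_closed closed_Collect_conj closed_Collect_le continuous_intros) auto

lemma emeasure_far_set_measurable [measurable]:
  "(\<lambda>x. emeasure lborel (far_set a \<epsilon> x)) \<in> borel_measurable borel"
proof -
  have "{p. snd p \<in> ellipsoid a \<and> 2 - \<epsilon> \<le> norm (fst p - snd p)} \<in> sets (borel :: ((real ^ 3) \<times> (real ^ 3)) measure)"
    by measurable
  then have "(\<lambda>x. emeasure lborel (Pair x -` {p. snd p \<in> ellipsoid a \<and> 2 - \<epsilon> \<le> norm (fst p - snd p)})) \<in> borel_measurable borel"
    by (intro lborel.measurable_emeasure_Pair) (simp add: borel_prod[symmetric])
  then show ?thesis by (simp add: far_set_def vimage_def)
qed

text \<open>The three substitutions for the second point have slopes \<open>\<epsilon> / 2\<close>,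
  \<open>sqrt \<epsilon>\<close> and \<open>a * sqrt \<epsilon>\<close>, whose product is the factor
  in front.\<close>

lemma emeasure_far_set_scaled:
  assumes a: "0 < a" and \<epsilon>: "0 < \<epsilon>" "\<epsilon> \<le> 2" and s: "y\<^sup>2 \<le> s" "\<epsilon> * s \<le> 1"
  shows "emeasure lborel (far_set a \<epsilon> (vec3 (sqrt (1 - \<epsilon> * s)) 0 (a * sqrt \<epsilon> * y)))
    = ennreal (a * \<epsilon>\<^sup>2 / 2) * (\<integral>\<^sup>+w. \<integral>\<^sup>+\<tau>. \<integral>\<^sup>+y'. indicator (near_set a \<epsilon>) (y, s, w, \<tau>, y') \<partial>lborel \<partial>lborel \<partial>lborel)"
proof -
  define S where "S = far_set a \<epsilon> (vec3 (sqrt (1 - \<epsilon> * s)) 0 (a * sqrt \<epsilon> * y))"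
  have [measurable]: "S \<in> sets borel" by (simp add: S_def)
  have sq: "(sqrt \<epsilon> * c)\<^sup>2 = \<epsilon> * c\<^sup>2" for c using \<epsilon> by (simp add: power_mult_distrib)
  \<comment> \<open>The summands \<open>0 +\<close> keep the shape \<open>t + c * x\<close> produced
    by \<open>nn_integral_real_affine\<close>.\<close>
  have mem: "vec3 (-1 + \<epsilon> / 2 * w) (0 + sqrt \<epsilon> * \<tau>) (0 + a * sqrt \<epsilon> * y') \<in> S \<longleftrightarrow> (y, s, w, \<tau>, y') \<in> near_set a \<epsilon>"
    for w \<tau> y'
  proof -
    have "vec3 (-1 + \<epsilon> / 2 * w) (0 + sqrt \<epsilon> * \<tau>) (0 + a * sqrt \<epsilon> * y') \<in> ellipsoid a
      \<longleftrightarrow> (-1 + \<epsilon> / 2 * w)\<^sup>2 + \<epsilon> * \<tau>\<^sup>2 + \<epsilon> * y'\<^sup>2 \<le> 1"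
      using a \<epsilon> by (simp add: ellipsoid_def power_mult_distrib)
    also have "(-1 + \<epsilon> / 2 * w)\<^sup>2 + \<epsilon> * \<tau>\<^sup>2 + \<epsilon> * y'\<^sup>2 = 1 + \<epsilon> * (\<epsilon> * w\<^sup>2 / 4 + \<tau>\<^sup>2 + y'\<^sup>2 - w)"
      by (simp add: power2_eq_square algebra_simps)
    also have "\<dots> \<le> 1 \<longleftrightarrow> \<epsilon> * w\<^sup>2 / 4 + \<tau>\<^sup>2 + y'\<^sup>2 \<le> w"
      using \<epsilon> by (simp add: mult_le_0_iff)
    finally have 1: "vec3 (-1 + \<epsilon> / 2 * w) (0 + sqrt \<epsilon> * \<tau>) (0 + a * sqrt \<epsilon> * y') \<in> ellipsoid a
      \<longleftrightarrow> \<epsilon> * w\<^sup>2 / 4 + \<tau>\<^sup>2 + y'\<^sup>2 \<le> w" .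
    have "norm (vec3 (sqrt (1 - \<epsilon> * s)) 0 (a * sqrt \<epsilon> * y) - vec3 (-1 + \<epsilon> / 2 * w) (0 + sqrt \<epsilon> * \<tau>) (0 + a * sqrt \<epsilon> * y'))
      = sqrt ((sqrt (1 - \<epsilon> * s) - (-1 + \<epsilon> / 2 * w))\<^sup>2 + (sqrt \<epsilon> * \<tau>)\<^sup>2 + (sqrt \<epsilon> * (a * (y - y')))\<^sup>2)"
      by (simp add: norm_vec_3 power2_commute algebra_simps)
    also have "\<dots> = sqrt ((sqrt (1 - \<epsilon> * s) + 1 - \<epsilon> * w / 2)\<^sup>2 + \<epsilon> * \<tau>\<^sup>2 + a\<^sup>2 * \<epsilon> * (y - y')\<^sup>2)"
      unfolding sq power_mult_distrib[of a "y - y'"] by (simp add: algebra_simps)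
    finally have 2: "2 - \<epsilon> \<le> norm (vec3 (sqrt (1 - \<epsilon> * s)) 0 (a * sqrt \<epsilon> * y) - vec3 (-1 + \<epsilon> / 2 * w) (0 + sqrt \<epsilon> * \<tau>) (0 + a * sqrt \<epsilon> * y'))
      \<longleftrightarrow> 2 - \<epsilon> \<le> sqrt ((sqrt (1 - \<epsilon> * s) + 1 - \<epsilon> * w / 2)\<^sup>2 + \<epsilon> * \<tau>\<^sup>2 + a\<^sup>2 * \<epsilon> * (y - y')\<^sup>2)" by simp
    \<comment> \<open>Squaring is an equivalence because \<open>\<epsilon> \<le> 2\<close> makes the
      left side nonnegative.\<close>
    have 3: "2 - \<epsilon> \<le> sqrt X \<longleftrightarrow> (2 - \<epsilon>)\<^sup>2 \<le> X" for X
    proof -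
      have "2 - \<epsilon> = sqrt ((2 - \<epsilon>)\<^sup>2)" using \<epsilon> by simp
      then show ?thesis by (metis real_sqrt_le_iff)
    qed
    show ?thesis
      unfolding S_def far_set_def mem_Collect_eq 1 2 3 using s by (simp add: near_set_def)
  qed
  then have ind: "indicator S (vec3 (-1 + \<epsilon> / 2 * w) (0 + sqrt \<epsilon> * \<tau>) (0 + a * sqrt \<epsilon> * y'))
      = (indicator (near_set a \<epsilon>) (y, s, w, \<tau>, y') :: ennreal)" for w \<tau> y'
    by (simp only: indicator_def)
  have "emeasure lborel S = (\<integral>\<^sup>+v. indicator S v \<partial>lborel)" by simp
  also have "\<dots> = (\<integral>\<^sup>+p. \<integral>\<^sup>+z. indicator S (vec3 (fst p) (snd p) z) \<partial>lborel \<partial>lborel)"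
    by (rule nn_integral_vec3) simp
  also have "\<dots> = (\<integral>\<^sup>+y1. \<integral>\<^sup>+y2. \<integral>\<^sup>+z. indicator S (vec3 y1 y2 z) \<partial>lborel \<partial>lborel \<partial>lborel)"
  proof -
    have "(\<lambda>p. \<integral>\<^sup>+z. indicator S (vec3 (fst p) (snd p) z) \<partial>lborel) \<in> borel_measurable borel" by measurable
    then show ?thesis by (subst nn_integral_lborel_pair) (simp_all only: fst_conv snd_conv)
  qed
  also have "\<dots> = (\<integral>\<^sup>+y1. \<integral>\<^sup>+y2. ennreal \<bar>a * sqrt \<epsilon>\<bar> *
      (\<integral>\<^sup>+y'. indicator S (vec3 y1 y2 (0 + a * sqrt \<epsilon> * y')) \<partial>lborel) \<partial>lborel \<partial>lborel)"
    using a \<epsilon> by (intro nn_integral_cong nn_integral_real_affine) auto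
  also have "\<dots> = (\<integral>\<^sup>+y1. ennreal \<bar>sqrt \<epsilon>\<bar> * (\<integral>\<^sup>+\<tau>. ennreal \<bar>a * sqrt \<epsilon>\<bar> *
      (\<integral>\<^sup>+y'. indicator S (vec3 y1 (0 + sqrt \<epsilon> * \<tau>) (0 + a * sqrt \<epsilon> * y')) \<partial>lborel) \<partial>lborel) \<partial>lborel)"
    using a \<epsilon> by (intro nn_integral_cong nn_integral_real_affine) auto
  also have "\<dots> = ennreal \<bar>\<epsilon> / 2\<bar> * (\<integral>\<^sup>+w. ennreal \<bar>sqrt \<epsilon>\<bar> * (\<integral>\<^sup>+\<tau>. ennreal \<bar>a * sqrt \<epsilon>\<bar> *
      (\<integral>\<^sup>+y'. indicator S (vec3 (-1 + \<epsilon> / 2 * w) (0 + sqrt \<epsilon> * \<tau>) (0 + a * sqrt \<epsilon> * y')) \<partial>lborel) \<partial>lborel) \<partial>lborel)"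
    using a \<epsilon> by (intro nn_integral_real_affine) auto
  also have "\<dots> = ennreal \<bar>\<epsilon> / 2\<bar> * (\<integral>\<^sup>+w. ennreal \<bar>sqrt \<epsilon>\<bar> * (\<integral>\<^sup>+\<tau>. ennreal \<bar>a * sqrt \<epsilon>\<bar> *
      (\<integral>\<^sup>+y'. indicator (near_set a \<epsilon>) (y, s, w, \<tau>, y') \<partial>lborel) \<partial>lborel) \<partial>lborel)"
    unfolding ind ..
  also have "\<dots> = ennreal \<bar>\<epsilon> / 2\<bar> * (ennreal \<bar>sqrt \<epsilon>\<bar> * (ennreal \<bar>a * sqrt \<epsilon>\<bar> * (\<integral>\<^sup>+w. \<integral>\<^sup>+\<tau>.
      \<integral>\<^sup>+y'. indicator (near_set a \<epsilon>) (y, s, w, \<tau>, y') \<partial>lborel \<partial>lborel \<partial>lborel)))"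
    by (simp add: nn_integral_cmult)
  also have "\<dots> = ennreal (\<bar>\<epsilon> / 2\<bar> * (\<bar>sqrt \<epsilon>\<bar> * \<bar>a * sqrt \<epsilon>\<bar>)) * (\<integral>\<^sup>+w. \<integral>\<^sup>+\<tau>.
      \<integral>\<^sup>+y'. indicator (near_set a \<epsilon>) (y, s, w, \<tau>, y') \<partial>lborel \<partial>lborel \<partial>lborel)"
    by (simp add: ennreal_mult mult.assoc del: times_divide_eq_right times_divide_eq_left abs_divide abs_mult)
  also have "\<bar>\<epsilon> / 2\<bar> * (\<bar>sqrt \<epsilon>\<bar> * \<bar>a * sqrt \<epsilon>\<bar>) = a * \<epsilon>\<^sup>2 / 2"
    using a \<epsilon> by (simp add: abs_mult power2_eq_square)
  finally show ?thesis unfolding S_def .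
qed

text \<open>At fixed height \<open>z\<close> the section is a disc, described by
  \<open>\<sigma> \<ge> z\<^sup>2 / a\<^sup>2\<close> for \<sigma> equal to 1 minus the squared
  distance from the axis. An integrand depending on \<sigma> and \<open>z\<close> alone sees
  \<sigma> with constant density \<open>pi\<close>.\<close>

lemma nn_integral_ellipsoid:
  assumes a: "0 < a" and h[measurable]: "case_prod h \<in> borel_measurable borel"
  shows "(\<integral>\<^sup>+x. indicator (ellipsoid a) x * h (1 - (x $ 1)\<^sup>2 - (x $ 2)\<^sup>2) (x $ 3) \<partial>lborel)
    = ennreal pi * (\<integral>\<^sup>+z. \<integral>\<^sup>+\<sigma>. indicator {z\<^sup>2 / a\<^sup>2..1} \<sigma> * h \<sigma> z \<partial>lborel \<partial>lborel)"
proof -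
  have h'[measurable (raw)]: "(\<lambda>x. h (f x) (g x)) \<in> borel_measurable M"
    if "f \<in> borel_measurable M" "g \<in> borel_measurable M" for f g and M :: "'b measure"
    using measurable_compose[OF borel_measurable_Pair[OF that] h] by simp
  have "(\<integral>\<^sup>+x. indicator (ellipsoid a) x * h (1 - (x $ 1)\<^sup>2 - (x $ 2)\<^sup>2) (x $ 3) \<partial>lborel)
    = (\<integral>\<^sup>+p. \<integral>\<^sup>+z. indicator (ellipsoid a) (vec3 (fst p) (snd p) z) * h (1 - (fst p)\<^sup>2 - (snd p)\<^sup>2) z \<partial>lborel \<partial>lborel)"
    by (subst nn_integral_vec3) simp_all
  also have "\<dots> = (\<integral>\<^sup>+z. \<integral>\<^sup>+p. indicator (ellipsoid a) (vec3 (fst p) (snd p) z) * h (1 - (fst p)\<^sup>2 - (snd p)\<^sup>2) z \<partial>lborel \<partial>lborel)"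
    by (intro nn_integral_swap) (simp add: case_prod_beta)
  also have "\<dots> = (\<integral>\<^sup>+z. \<integral>\<^sup>+p. indicator {z\<^sup>2 / a\<^sup>2..} (1 - (fst p)\<^sup>2 - (snd p)\<^sup>2) * h (1 - (fst p)\<^sup>2 - (snd p)\<^sup>2) z \<partial>(lborel :: (real \<times> real) measure) \<partial>lborel)"
    by (intro nn_integral_cong arg_cong2[where f="(*)"] refl) (auto simp: indicator_def ellipsoid_def)
  also have "\<dots> = (\<integral>\<^sup>+z. ennreal pi * (\<integral>\<^sup>+\<sigma>. indicator {..1} \<sigma> * (indicator {z\<^sup>2 / a\<^sup>2..} \<sigma> * h \<sigma> z) \<partial>lborel) \<partial>lborel)"
    by (intro nn_integral_cong nn_integral_radial) measurable
  also have "\<dots> = (\<integral>\<^sup>+z. ennreal pi * (\<integral>\<^sup>+\<sigma>. indicator {z\<^sup>2 / a\<^sup>2..1} \<sigma> * h \<sigma> z \<partial>lborel) \<partial>lborel)"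
    by (intro nn_integral_cong, rule arg_cong2[where f="(*)"], rule refl, intro nn_integral_cong)
      (auto simp: indicator_def)
  also have "\<dots> = ennreal pi * (\<integral>\<^sup>+z. \<integral>\<^sup>+\<sigma>. indicator {z\<^sup>2 / a\<^sup>2..1} \<sigma> * h \<sigma> z \<partial>lborel \<partial>lborel)"
    unfolding atLeastAtMost_iff indicator_def by (rule nn_integral_cmult) measurable
  finally show ?thesis .
qed

lemma emeasure_ellipsoid:
  assumes a: "0 < a"
  shows "emeasure lborel (ellipsoid a) = ennreal (4 * pi * a / 3)"
proof -
  have "emeasure lborel (ellipsoid a) = (\<integral>\<^sup>+x. indicator (ellipsoid a) x * 1 \<partial>lborel)" by simp
  also have "\<dots> = ennreal pi * (\<integral>\<^sup>+z. \<integral>\<^sup>+\<sigma>. indicator {z\<^sup>2 / a\<^sup>2..1} \<sigma> * 1 \<partial>lborel \<partial>lborel)"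
    using nn_integral_ellipsoid[OF a, of "\<lambda>_ _. 1"] by simp
  also have "(\<integral>\<^sup>+z. \<integral>\<^sup>+\<sigma>. indicator {z\<^sup>2 / a\<^sup>2..1} \<sigma> * 1 \<partial>lborel \<partial>lborel)
    = (\<integral>\<^sup>+z. ennreal (1 - z\<^sup>2 / a\<^sup>2) * indicator {- a..a} z \<partial>lborel)"
  proof (rule nn_integral_cong)
    fix z :: real
    have "z\<^sup>2 / a\<^sup>2 \<le> 1 \<longleftrightarrow> z \<in> {- a..a}" using a abs_le_square_iff[of z a] by auto
    then show "(\<integral>\<^sup>+\<sigma>. indicator {z\<^sup>2 / a\<^sup>2..1} \<sigma> * 1 \<partial>lborel) = ennreal (1 - z\<^sup>2 / a\<^sup>2) * indicator {- a..a} z"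
      by (cases "z \<in> {- a..a}") auto
  qed
  also have "\<dots> = ennreal ((a - a ^ 3 / (3 * a\<^sup>2)) - (- a - (- a) ^ 3 / (3 * a\<^sup>2)))"
  proof (rule nn_integral_FTC_Icc)
    show "((\<lambda>z. z - z ^ 3 / (3 * a\<^sup>2)) has_real_derivative 1 - z\<^sup>2 / a\<^sup>2) (at z)" for z
      using a by (auto intro!: derivative_eq_intros simp: power2_eq_square)
    show "0 \<le> 1 - z\<^sup>2 / a\<^sup>2" if "z \<in> {- a..a}" for z
      using that a abs_le_square_iff[of z a] by auto
  qed (use a in auto)
  also have "(a - a ^ 3 / (3 * a\<^sup>2)) - (- a - (- a) ^ 3 / (3 * a\<^sup>2)) = 4 * a / 3"
    using a by (simp add: power2_eq_square power3_eq_cube field_simps)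
  also have "ennreal pi * ennreal (4 * a / 3) = ennreal (4 * pi * a / 3)"
    using a by (subst ennreal_mult[symmetric]) (auto simp: mult_ac)
  finally show ?thesis .
qed

text \<open>The prefactor collects \<open>pi\<close> from the discs,
  \<open>a * sqrt \<epsilon>\<close> from the height, \<epsilon> from the depth of the first point,
  and \<open>a * \<epsilon>\<^sup>2 / 2\<close> from the second point.\<close>

lemma nn_integral_far_set:
  assumes a: "0 < a" "a < 1" and \<epsilon>: "0 < \<epsilon>" "\<epsilon> \<le> 2"
  shows "(\<integral>\<^sup>+x. indicator (ellipsoid a) x * emeasure lborel (far_set a \<epsilon> x) \<partial>lborel)
    = ennreal (pi * a\<^sup>2 / 2 * \<epsilon> powr (7 / 2)) * emeasure lborel (near_set a \<epsilon>)"
proof -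
  define h where "h \<sigma> z = emeasure lborel (far_set a \<epsilon> (vec3 (sqrt (1 - \<sigma>)) 0 z))" for \<sigma> z
  define c where "c = a * sqrt \<epsilon>"
  have c: "0 < c" using a \<epsilon> by (simp add: c_def)
  have h'[measurable (raw)]: "(\<lambda>x. h (f x) (g x)) \<in> borel_measurable M"
    if "f \<in> borel_measurable M" "g \<in> borel_measurable M" for f g and M :: "'b measure"
    unfolding h_def by (rule measurable_compose[OF _ emeasure_far_set_measurable]) (use that in measurable)
  \<comment> \<open>The constraints on the first point are part of \<open>near_set\<close>, so its
    indicator is absorbed: where they fail, both sides vanish.\<close>
  have key: "indicator {(0 + c * y)\<^sup>2 / a\<^sup>2..1} (0 + \<epsilon> * s) * h (0 + \<epsilon> * s) (0 + c * y) = ennreal (a * \<epsilon>\<^sup>2 / 2) *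
      (\<integral>\<^sup>+w. \<integral>\<^sup>+\<tau>. \<integral>\<^sup>+y'. indicator (near_set a \<epsilon>) (y, s, w, \<tau>, y') \<partial>lborel \<partial>lborel \<partial>lborel)" for y s
  proof -
    have eq: "(c * y)\<^sup>2 / a\<^sup>2 = \<epsilon> * y\<^sup>2" using a \<epsilon> by (simp add: c_def power_mult_distrib)
    show ?thesis
    proof (cases "y\<^sup>2 \<le> s \<and> \<epsilon> * s \<le> 1")
      case True
      then show ?thesis
        using emeasure_far_set_scaled[OF a(1) \<epsilon>, of y s, folded c_def] \<epsilon> by (simp add: eq h_def)
    next
      case False
      then have "indicator (near_set a \<epsilon>) (y, s, w, \<tau>, y') = (0 :: ennreal)" for w \<tau> y'
        by (auto simp: near_set_def)
      then show ?thesis using False \<epsilon> by (auto simp: eq indicator_def)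
    qed
  qed
  have "(\<integral>\<^sup>+x. indicator (ellipsoid a) x * emeasure lborel (far_set a \<epsilon> x) \<partial>lborel)
    = (\<integral>\<^sup>+x. indicator (ellipsoid a) x * h (1 - (x $ 1)\<^sup>2 - (x $ 2)\<^sup>2) (x $ 3) \<partial>lborel)"
    using emeasure_far_set_rotate[OF a] by (auto simp: h_def intro!: nn_integral_cong)
  also have "\<dots> = ennreal pi * (\<integral>\<^sup>+z. \<integral>\<^sup>+\<sigma>. indicator {z\<^sup>2 / a\<^sup>2..1} \<sigma> * h \<sigma> z \<partial>lborel \<partial>lborel)"
    using a by (intro nn_integral_ellipsoid) (auto simp: case_prod_beta)
  also have "\<dots> = ennreal pi * (\<integral>\<^sup>+z. ennreal \<bar>\<epsilon>\<bar> * (\<integral>\<^sup>+s. indicator {z\<^sup>2 / a\<^sup>2..1} (0 + \<epsilon> * s) * h (0 + \<epsilon> * s) z \<partial>lborel) \<partial>lborel)"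
    using \<epsilon> by (intro arg_cong2[where f="(*)"] refl nn_integral_cong nn_integral_real_affine) auto
  also have "\<dots> = ennreal pi * (ennreal \<bar>c\<bar> * (\<integral>\<^sup>+y. ennreal \<bar>\<epsilon>\<bar> *
      (\<integral>\<^sup>+s. indicator {(0 + c * y)\<^sup>2 / a\<^sup>2..1} (0 + \<epsilon> * s) * h (0 + \<epsilon> * s) (0 + c * y) \<partial>lborel) \<partial>lborel))"
    using c unfolding indicator_def atLeastAtMost_iff by (intro arg_cong2[where f="(*)"] refl nn_integral_real_affine) auto
  also have "\<dots> = ennreal pi * (ennreal \<bar>c\<bar> * (\<integral>\<^sup>+y. ennreal \<bar>\<epsilon>\<bar> * (\<integral>\<^sup>+s. ennreal (a * \<epsilon>\<^sup>2 / 2) *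
      (\<integral>\<^sup>+w. \<integral>\<^sup>+\<tau>. \<integral>\<^sup>+y'. indicator (near_set a \<epsilon>) (y, s, w, \<tau>, y') \<partial>lborel \<partial>lborel \<partial>lborel) \<partial>lborel) \<partial>lborel))"
    unfolding key ..
  also have "\<dots> = ennreal pi * (ennreal \<bar>c\<bar> * (ennreal \<bar>\<epsilon>\<bar> * (ennreal (a * \<epsilon>\<^sup>2 / 2) * (\<integral>\<^sup>+y. \<integral>\<^sup>+s.
      \<integral>\<^sup>+w. \<integral>\<^sup>+\<tau>. \<integral>\<^sup>+y'. indicator (near_set a \<epsilon>) (y, s, w, \<tau>, y') \<partial>lborel \<partial>lborel \<partial>lborel \<partial>lborel \<partial>lborel))))"
    by (simp add: nn_integral_cmult)
  also have "\<dots> = ennreal (pi * (\<bar>c\<bar> * (\<bar>\<epsilon>\<bar> * (a * \<epsilon>\<^sup>2 / 2)))) * (\<integral>\<^sup>+y. \<integral>\<^sup>+s.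
      \<integral>\<^sup>+w. \<integral>\<^sup>+\<tau>. \<integral>\<^sup>+y'. indicator (near_set a \<epsilon>) (y, s, w, \<tau>, y') \<partial>lborel \<partial>lborel \<partial>lborel \<partial>lborel \<partial>lborel)"
    using a by (simp add: ennreal_mult mult.assoc del: times_divide_eq_right times_divide_eq_left)
  also have "pi * (\<bar>c\<bar> * (\<bar>\<epsilon>\<bar> * (a * \<epsilon>\<^sup>2 / 2))) = pi * a\<^sup>2 / 2 * \<epsilon> powr (7 / 2)"
  proof -
    have "\<epsilon> powr (7 / 2) = \<epsilon> powr (1 / 2) * \<epsilon> powr real 3" by (simp flip: powr_add)
    also have "\<dots> = sqrt \<epsilon> * \<epsilon> ^ 3"
      using \<epsilon> by (simp only: powr_half_sqrt less_imp_le powr_realpow)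
    finally show ?thesis using a \<epsilon> by (simp add: c_def abs_mult power2_eq_square power3_eq_cube)
  qed
  also have "(\<integral>\<^sup>+y. \<integral>\<^sup>+s. \<integral>\<^sup>+w. \<integral>\<^sup>+\<tau>. \<integral>\<^sup>+y'. indicator (near_set a \<epsilon>) (y, s, w, \<tau>, y') \<partial>lborel \<partial>lborel \<partial>lborel \<partial>lborel \<partial>lborel)
    = (\<integral>\<^sup>+p. indicator (near_set a \<epsilon>) p \<partial>lborel)"
    by (rule nn_integral_lborel_5[symmetric]) measurable
  finally show ?thesis by simp
qed

section \<open>A common box for the scaled regions, and their limit\<close>

definition limit_set :: "real \<Rightarrow> (real \<times> real \<times> real \<times> real \<times> real) set" where
  "limit_set a = {(y, s, w, \<tau>, y'). y\<^sup>2 \<le> s \<and> \<tau>\<^sup>2 + y'\<^sup>2 \<le> w \<and>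
    (s + w) / 2 - \<tau>\<^sup>2 / 4 - a\<^sup>2 / 4 * (y - y')\<^sup>2 \<le> 1}"

lemma limit_set_sets [measurable]: "limit_set a \<in> sets borel"
  unfolding limit_set_def case_prod_beta
  by (intro borel_closed closed_Collect_conj closed_Collect_le continuous_intros) auto

text \<open>The bounds \<open>(x + v)\<^sup>2 \<le> 2 * x\<^sup>2 + 2 * v\<^sup>2\<close> and
  \<open>(y - y')\<^sup>2 \<le> 2 * s + 2 * y'\<^sup>2\<close> turn the distance condition into a
  coercive inequality with coefficient \<open>d = 1 - a\<^sup>2 > 0\<close>. It controls every
  coordinate except \<open>w\<close>. The 16 in \<open>B\<close> comes from \<open>w\<close>, for
  which \<open>w / 2 \<le> 8 * c\<close> with \<open>c = 1 / d\<close>.\<close>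

lemma near_set_bounds:
  fixes a :: real
  assumes a: "0 < a" "a < 1" and \<epsilon>: "0 < \<epsilon>" "\<epsilon> \<le> (1 - a\<^sup>2) / 16"
    and mem: "(y, s, w, \<tau>, y') \<in> near_set a \<epsilon>"
  defines "B \<equiv> 16 / (1 - a\<^sup>2)"
  shows "\<bar>y\<bar> \<le> B" "\<bar>s\<bar> \<le> B" "\<bar>w\<bar> \<le> B" "\<bar>\<tau>\<bar> \<le> B" "\<bar>y'\<bar> \<le> B"
proof -
  define d where "d = 1 - a\<^sup>2"
  define c where "c = 1 / d"
  define x v where "x = sqrt (1 - \<epsilon> * s)" and "v = 1 - \<epsilon> * w / 2"
  have d: "0 < d" "d \<le> 1" using a by (auto simp: d_def power_less_one_iff abs_square_less_1)
  have c1: "1 \<le> c" using d by (simp add: c_def)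
  have B: "B = 16 * c" by (simp add: B_def c_def d_def)
  have \<epsilon>c: "\<epsilon> * c \<le> 1 / 16"
    using mult_right_mono[OF \<epsilon>(2), of c] c1 d by (simp add: c_def d_def[symmetric])
  from mem have ys: "y\<^sup>2 \<le> s" and s1: "\<epsilon> * s \<le> 1" and w: "\<epsilon> * w\<^sup>2 / 4 + \<tau>\<^sup>2 + y'\<^sup>2 \<le> w"
    and D: "(2 - \<epsilon>)\<^sup>2 \<le> (x + v)\<^sup>2 + \<epsilon> * \<tau>\<^sup>2 + a\<^sup>2 * \<epsilon> * (y - y')\<^sup>2"
    by (auto simp: near_set_def x_def v_def add_diff_eq)
  have s0: "0 \<le> s" using ys zero_le_power2[of y] by linarith
  have x: "0 \<le> x" "x\<^sup>2 = 1 - \<epsilon> * s" using s1 by (auto simp: x_def)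
  have "x\<^sup>2 \<le> 1" using x s0 \<epsilon> by simp
  then have x1: "x \<le> 1" using x(1) by (simp add: abs_square_le_1)
  have v2: "v\<^sup>2 = 1 - \<epsilon> * (w - \<epsilon> * w\<^sup>2 / 4)" by (simp add: v_def power2_eq_square algebra_simps)
  have "\<epsilon> * (\<tau>\<^sup>2 + y'\<^sup>2) \<le> \<epsilon> * (w - \<epsilon> * w\<^sup>2 / 4)" using w \<epsilon> by (intro mult_left_mono) auto
  then have vE: "v\<^sup>2 \<le> 1 - \<epsilon> * \<tau>\<^sup>2 - \<epsilon> * y'\<^sup>2" unfolding v2 by (simp add: algebra_simps)
  have yy: "(y - y')\<^sup>2 \<le> 2 * s + 2 * y'\<^sup>2"
    using zero_le_power2[of "y + y'"] ys by (simp add: power2_eq_square algebra_simps)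
  have ayy: "a\<^sup>2 * \<epsilon> * (y - y')\<^sup>2 \<le> a\<^sup>2 * \<epsilon> * (2 * s + 2 * y'\<^sup>2)"
    using yy \<epsilon> by (intro mult_left_mono) auto
  have e4: "4 - 4 * \<epsilon> \<le> (2 - \<epsilon>)\<^sup>2" by (simp add: power2_eq_square algebra_simps)
  have xv: "(x + v)\<^sup>2 \<le> 2 * (1 - \<epsilon> * s) + 2 * v\<^sup>2"
    unfolding x(2)[symmetric] using zero_le_power2[of "x - v"] by (simp add: power2_eq_square algebra_simps)
  have H: "4 - 4 * \<epsilon> \<le> 2 * (1 - \<epsilon> * s) + 2 * v\<^sup>2 + (\<epsilon> * \<tau>\<^sup>2 + a\<^sup>2 * \<epsilon> * (2 * s + 2 * y'\<^sup>2))"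
    using D e4 xv ayy by linarith
  \<comment> \<open>All terms of order 0 cancel between \<open>H\<close> and \<open>vE\<close>; what
    remains is a multiple of \<epsilon>, and dividing leaves a bound free of \<epsilon>.\<close>
  have "\<epsilon> * (2 * d * s + \<tau>\<^sup>2 + 2 * d * y'\<^sup>2) \<le> \<epsilon> * 4"
    using H vE by (simp add: d_def algebra_simps)
  then have sum: "2 * d * s + \<tau>\<^sup>2 + 2 * d * y'\<^sup>2 \<le> 4" using \<epsilon> by simp
  have nn: "0 \<le> 2 * d * s" "0 \<le> \<tau>\<^sup>2" "0 \<le> 2 * d * y'\<^sup>2" using d s0 by auto
  have "d * s \<le> 2" "d * y'\<^sup>2 \<le> 2" and \<tau>2: "\<tau>\<^sup>2 \<le> 4" using sum nn by linarith+
  then have sc: "s \<le> 2 * c" "y'\<^sup>2 \<le> 2 * c" using d by (auto simp: c_def field_simps)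
  have sq_bound: "\<bar>z\<bar> \<le> 2 * c" if "z\<^sup>2 \<le> 2 * c" for z
  proof -
    have "2 * c \<le> (2 * c)\<^sup>2" using c1 by (simp add: power2_eq_square)
    then show ?thesis using that c1 abs_le_square_iff[of z "2 * c"] by simp
  qed
  show "\<bar>y\<bar> \<le> B" using sq_bound[of y] ys sc c1 by (simp add: B)
  show "\<bar>y'\<bar> \<le> B" using sq_bound[of y'] sc c1 by (simp add: B)
  show "\<bar>s\<bar> \<le> B" using sc s0 c1 by (simp add: B)
  show "\<bar>\<tau>\<bar> \<le> B" using sq_bound[of \<tau>] \<tau>2 abs_le_square_iff[of \<tau> 2] c1 by (simp add: B)
  have a1: "a\<^sup>2 \<le> 1" using d by (simp add: d_def)
  have "a\<^sup>2 * (2 * s + 2 * y'\<^sup>2) \<le> 1 * (2 * s + 2 * y'\<^sup>2)" using a1 s0 by (intro mult_right_mono) auto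
  moreover have "2 * s + 2 * y'\<^sup>2 \<le> 8 * c" using sc by linarith
  ultimately have "a\<^sup>2 * (2 * s + 2 * y'\<^sup>2) \<le> 8 * c" by simp
  then have "\<tau>\<^sup>2 + a\<^sup>2 * (2 * s + 2 * y'\<^sup>2) \<le> 4 + 8 * c" using \<tau>2 by (rule add_mono[rotated])
  then have "\<epsilon> * (\<tau>\<^sup>2 + a\<^sup>2 * (2 * s + 2 * y'\<^sup>2)) \<le> \<epsilon> * (4 + 8 * c)" using \<epsilon> by (intro mult_left_mono) auto
  then have err: "\<epsilon> * \<tau>\<^sup>2 + a\<^sup>2 * \<epsilon> * (2 * s + 2 * y'\<^sup>2) \<le> 4 * \<epsilon> + 8 * (\<epsilon> * c)"
    by (simp add: algebra_simps)
  have \<epsilon>1: "\<epsilon> \<le> \<epsilon> * c" using c1 \<epsilon> by simp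
  \<comment> \<open>A bound on \<open>w - \<epsilon> * w\<^sup>2 / 4\<close> would still allow
    \<open>w\<close> near \<open>4 / \<epsilon>\<close>, where the second point lies on the side of
    the first. As \<open>v\<close> is minus the first coordinate of the second point, a negative
    \<open>v\<close> gives \<open>\<bar>x + v\<bar> \<le> 1\<close>, too small for a far pair: it
    would force \<open>3 \<le> 16 * (\<epsilon> * c)\<close>, against
    \<open>\<epsilon> * c \<le> 1 / 16\<close>.\<close>
  have "0 \<le> v"
  proof (rule ccontr)
    assume "\<not> 0 \<le> v"
    moreover have "v\<^sup>2 \<le> 1" using vE \<epsilon> by (smt (verit) mult_nonneg_nonneg zero_le_power2)
    then have "\<bar>v\<bar> \<le> 1" by (simp add: abs_square_le_1)
    ultimately have "\<bar>x + v\<bar> \<le> 1" using x x1 by linarith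
    then have "(x + v)\<^sup>2 \<le> 1" by (simp add: abs_square_le_1)
    then show False using D e4 ayy err \<epsilon>c \<epsilon>1 by linarith
  qed
  then have \<epsilon>w: "\<epsilon> * w \<le> 2" by (simp add: v_def)
  have w0: "0 \<le> w" using w \<epsilon> by (smt (verit) zero_le_power2 mult_nonneg_nonneg divide_nonneg_pos)
  have "0 \<le> \<epsilon> * s" using s0 \<epsilon> by simp
  then have "1 - v\<^sup>2 \<le> 8 * (\<epsilon> * c)" using H err \<epsilon>1 by argo
  then have "\<epsilon> * (w - \<epsilon> * w\<^sup>2 / 4) \<le> \<epsilon> * (8 * c)" unfolding v2 by (simp only: diff_diff_eq2 add_diff_cancel_left' mult.left_commute)
  then have "w - \<epsilon> * w\<^sup>2 / 4 \<le> 8 * c" using \<epsilon> by (simp add: mult_le_cancel_left_pos)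
  moreover have "\<epsilon> * w\<^sup>2 \<le> 2 * w"
    using mult_right_mono[OF \<epsilon>w w0] by (simp add: power2_eq_square mult.assoc)
  ultimately show "\<bar>w\<bar> \<le> B" using w0 by (simp add: B)
qed

text \<open>Every point of the ellipsoid has scaled coordinates after rotation, and the box of
  \<open>near_set_bounds\<close> depends neither on the point nor on \<epsilon>. Hence one
  \<open>C\<close>, chosen before both, serves all of them; it supplies the bound \<open>b\<close>
  on sections in the void probability estimate.\<close>

lemma emeasure_far_set_le:
  fixes a :: real
  assumes a: "0 < a" "a < 1"
  obtains C where "0 \<le> C" "\<And>\<epsilon> x. 0 < \<epsilon> \<Longrightarrow> \<epsilon> \<le> (1 - a\<^sup>2) / 16 \<Longrightarrow> x \<in> ellipsoid a \<Longrightarrow>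
    emeasure lborel (far_set a \<epsilon> x) \<le> ennreal (C * \<epsilon>\<^sup>2)"
proof
  define B where "B = 16 / (1 - a\<^sup>2)"
  define R where "R = cbox (- B, - B, - B) (B, B, B)"
  define C where "C = a / 2 * measure lborel R"
  show "0 \<le> C" using a by (simp add: C_def)
  fix \<epsilon> :: real and x assume \<epsilon>: "0 < \<epsilon>" "\<epsilon> \<le> (1 - a\<^sup>2) / 16" and x: "x \<in> ellipsoid a"
  define s y where "s = (1 - (x $ 1)\<^sup>2 - (x $ 2)\<^sup>2) / \<epsilon>" and "y = x $ 3 / (a * sqrt \<epsilon>)"
  have \<epsilon>2: "\<epsilon> \<le> 2" using order_trans[OF \<epsilon>(2), of 2] by (simp add: field_simps)
  have \<epsilon>s: "\<epsilon> * s = 1 - (x $ 1)\<^sup>2 - (x $ 2)\<^sup>2" and cy: "a * sqrt \<epsilon> * y = x $ 3"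
    using \<epsilon> a by (auto simp: s_def y_def)
  have "\<epsilon> * y\<^sup>2 = (x $ 3)\<^sup>2 / a\<^sup>2"
    using \<epsilon> a by (simp add: y_def power_divide power_mult_distrib)
  then have "\<epsilon> * y\<^sup>2 \<le> \<epsilon> * s" using x by (simp add: \<epsilon>s ellipsoid_def)
  then have ys: "y\<^sup>2 \<le> s" using \<epsilon>(1) by (simp only: mult_le_cancel_left_pos)
  have s1: "\<epsilon> * s \<le> 1" by (simp add: \<epsilon>s)
  have "emeasure lborel (far_set a \<epsilon> x) = emeasure lborel (far_set a \<epsilon> (vec3 (sqrt (1 - \<epsilon> * s)) 0 (a * sqrt \<epsilon> * y)))"
    unfolding cy \<epsilon>s by (subst emeasure_far_set_rotate[OF a]) simp
  also have "\<dots> = ennreal (a * \<epsilon>\<^sup>2 / 2) * (\<integral>\<^sup>+w. \<integral>\<^sup>+\<tau>. \<integral>\<^sup>+y'. indicator (near_set a \<epsilon>) (y, s, w, \<tau>, y') \<partial>lborel \<partial>lborel \<partial>lborel)"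
    by (rule emeasure_far_set_scaled[OF a(1) \<epsilon>(1) \<epsilon>2 ys s1])
  also have "\<dots> \<le> ennreal (a * \<epsilon>\<^sup>2 / 2) * (\<integral>\<^sup>+w. \<integral>\<^sup>+\<tau>. \<integral>\<^sup>+y'. indicator R (w, \<tau>, y') \<partial>lborel \<partial>lborel \<partial>lborel)"
  proof (intro mult_left_mono nn_integral_mono)
    show "indicator (near_set a \<epsilon>) (y, s, w, \<tau>, y') \<le> (indicator R (w, \<tau>, y') :: ennreal)" for w \<tau> y'
      using near_set_bounds[OF a \<epsilon>, of y s w \<tau> y'] by (auto simp: indicator_def R_def B_def)
  qed simp
  also have "(\<integral>\<^sup>+w. \<integral>\<^sup>+\<tau>. \<integral>\<^sup>+y'. indicator R (w, \<tau>, y') \<partial>lborel \<partial>lborel \<partial>lborel) = (\<integral>\<^sup>+p. indicator R p \<partial>lborel)"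
  proof -
    have [measurable]: "R \<in> sets borel" by (simp add: R_def)
    have "(\<integral>\<^sup>+p. indicator R p \<partial>lborel) = (\<integral>\<^sup>+w. \<integral>\<^sup>+q. indicator R (w, q) \<partial>lborel \<partial>lborel)"
      by (rule nn_integral_lborel_pair) simp
    also have "\<dots> = (\<integral>\<^sup>+w. \<integral>\<^sup>+\<tau>. \<integral>\<^sup>+y'. indicator R (w, \<tau>, y') \<partial>lborel \<partial>lborel \<partial>lborel)"
      by (intro nn_integral_cong nn_integral_lborel_pair) measurable
    finally show ?thesis ..
  qed
  also have "\<dots> = ennreal (measure lborel R)"
    by (simp add: R_def emeasure_lborel_cbox_eq measure_lborel_cbox_eq)
  also have "ennreal (a * \<epsilon>\<^sup>2 / 2) * ennreal (measure lborel R) = ennreal (C * \<epsilon>\<^sup>2)"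
    using a by (subst ennreal_mult[symmetric]) (auto simp: C_def)
  finally show "emeasure lborel (far_set a \<epsilon> x) \<le> ennreal (C * \<epsilon>\<^sup>2)" .
qed

lemma finite_square_roots: "finite {z :: real. z\<^sup>2 = k}"
  by (rule finite_subset[of _ "{sqrt k, - sqrt k}"]) (auto simp: real_sqrt_abs)

text \<open>With the other four coordinates fixed, each excluded equation is a nontrivial quadratic
  in \<open>y'\<close> and has finitely many roots; Tonelli's theorem with \<open>y'\<close>
  innermost gives a null set.\<close>

lemma AE_not_limit_boundary:
  assumes a: "0 < a"
  shows "AE (y, s, w, \<tau>, y') in lborel. \<tau>\<^sup>2 + y'\<^sup>2 \<noteq> w \<and> (s + w) / 2 - \<tau>\<^sup>2 / 4 - a\<^sup>2 / 4 * (y - y')\<^sup>2 \<noteq> (1 :: real)"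
proof -
  define N where "N = {(y :: real, s, w, \<tau>, y'). \<not> (\<tau>\<^sup>2 + y'\<^sup>2 \<noteq> w \<and> (s + w) / 2 - \<tau>\<^sup>2 / 4 - a\<^sup>2 / 4 * (y - y')\<^sup>2 \<noteq> 1)}"
  have [measurable]: "N \<in> sets borel"
    unfolding N_def case_prod_beta de_Morgan_conj not_not
    by (intro borel_closed closed_Collect_disj closed_Collect_eq continuous_intros) auto
  have "(\<integral>\<^sup>+y'. indicator N (y, s, w, \<tau>, y') \<partial>lborel) = 0" for y s w \<tau>
  proof -
    have "{y'. (y, s, w, \<tau>, y') \<in> N} \<subseteq> {z. z\<^sup>2 = w - \<tau>\<^sup>2} \<union> (\<lambda>z. y - z) ` {z. z\<^sup>2 = ((s + w) / 2 - \<tau>\<^sup>2 / 4 - 1) * 4 / a\<^sup>2}"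
    proof
      fix y' assume "y' \<in> {y'. (y, s, w, \<tau>, y') \<in> N}"
      then consider "\<tau>\<^sup>2 + y'\<^sup>2 = w" | "(s + w) / 2 - \<tau>\<^sup>2 / 4 - a\<^sup>2 / 4 * (y - y')\<^sup>2 = 1"
        unfolding N_def by blast
      then show "y' \<in> {z. z\<^sup>2 = w - \<tau>\<^sup>2} \<union> (\<lambda>z. y - z) ` {z. z\<^sup>2 = ((s + w) / 2 - \<tau>\<^sup>2 / 4 - 1) * 4 / a\<^sup>2}"
      proof cases
        case 2
        then have "(y - y')\<^sup>2 = ((s + w) / 2 - \<tau>\<^sup>2 / 4 - 1) * 4 / a\<^sup>2" using a by (simp add: field_simps)
        then show ?thesis by (intro UnI2 image_eqI[where x="y - y'"]) auto
      qed auto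
    qed
    then have "finite {y'. (y, s, w, \<tau>, y') \<in> N}"
      by (rule finite_subset) (intro finite_UnI finite_imageI finite_square_roots)
    then have "emeasure lborel {y'. (y, s, w, \<tau>, y') \<in> N} = 0" "{y'. (y, s, w, \<tau>, y') \<in> N} \<in> sets borel"
      by (auto intro!: emeasure_lborel_countable countable_finite borel_closed finite_imp_closed)
    moreover have "(\<lambda>y'. indicator N (y, s, w, \<tau>, y')) = (indicator {y'. (y, s, w, \<tau>, y') \<in> N} :: real \<Rightarrow> ennreal)"
      by (auto simp: indicator_def)
    ultimately show ?thesis by simp
  qed
  then have "(\<integral>\<^sup>+p. indicator N p \<partial>lborel) = 0"
    by (subst nn_integral_lborel_5) simp_all
  then have "N \<in> null_sets lborel" by (simp add: null_sets_def)
  then have "AE p in lborel. p \<notin> N" by (rule AE_not_in)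
  then show ?thesis by eventually_elim (auto simp: N_def)
qed

text \<open>Off the two surfaces, each limiting inequality holds or fails strictly, so its truth
  value is eventually constant along the sequence. The constraint \<open>y\<^sup>2 \<le> s\<close>
  is common to both sets.\<close>

lemma near_set_pointwise_limit:
  fixes e :: "nat \<Rightarrow> real"
  assumes e: "\<And>n. 0 < e n" "e \<longlonglongrightarrow> 0"
    and bd: "\<tau>\<^sup>2 + y'\<^sup>2 \<noteq> w" "(s + w) / 2 - \<tau>\<^sup>2 / 4 - a\<^sup>2 / 4 * (y - y')\<^sup>2 \<noteq> 1"
  shows "eventually (\<lambda>n. (y, s, w, \<tau>, y') \<in> near_set a (e n) \<longleftrightarrow> (y, s, w, \<tau>, y') \<in> limit_set a) sequentially"
proof -
  \<comment> \<open>Since \<open>f 0 = 0\<close>, the quotient \<open>f u / u\<close> tends to the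
    derivative at 0. This is the first-order expansion of the squared distance condition, which
    after division by \<open>4 * u\<close> becomes the last inequality of
    \<open>limit_set\<close>.\<close>
  define f where "f u = (sqrt (1 - u * s) + 1 - u * w / 2)\<^sup>2 - (2 - u)\<^sup>2" for u
  define L where "L = 1 - ((s + w) / 2 - \<tau>\<^sup>2 / 4 - a\<^sup>2 / 4 * (y - y')\<^sup>2)"
  have "(f has_real_derivative 4 - 2 * (s + w)) (at 0)"
    unfolding f_def by (auto intro!: derivative_eq_intros simp: field_simps)
  then have "(\<lambda>h. (f (0 + h) - f 0) / h) \<midarrow>0\<rightarrow> 4 - 2 * (s + w)" by (rule DERIV_D)
  moreover have "f 0 = 0" by (simp add: f_def)
  moreover have "filterlim e (at 0) sequentially"
    using e by (intro filterlim_atI) (auto simp: less_imp_neq[THEN not_sym] intro!: always_eventually)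
  ultimately have "(\<lambda>n. f (e n) / e n) \<longlonglongrightarrow> 4 - 2 * (s + w)"
    by (auto dest: filterlim_compose)
  then have lim3: "(\<lambda>n. f (e n) / e n + \<tau>\<^sup>2 + a\<^sup>2 * (y - y')\<^sup>2) \<longlonglongrightarrow> 4 * L"
  proof -
    have "(\<lambda>n. f (e n) / e n + \<tau>\<^sup>2 + a\<^sup>2 * (y - y')\<^sup>2) \<longlonglongrightarrow> 4 - 2 * (s + w) + \<tau>\<^sup>2 + a\<^sup>2 * (y - y')\<^sup>2"
      by (intro tendsto_add tendsto_const) fact
    also have "4 - 2 * (s + w) + \<tau>\<^sup>2 + a\<^sup>2 * (y - y')\<^sup>2 = 4 * L" by (simp add: L_def field_simps)
    finally show ?thesis .
  qed
  have lim1: "(\<lambda>n. e n * s) \<longlonglongrightarrow> 0" by (rule tendsto_eq_intros e refl)+ simp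
  have lim2: "(\<lambda>n. e n * w\<^sup>2 / 4 + \<tau>\<^sup>2 + y'\<^sup>2) \<longlonglongrightarrow> \<tau>\<^sup>2 + y'\<^sup>2"
    using e(2) by (auto intro!: tendsto_eq_intros)
  have ev1: "eventually (\<lambda>n. e n * s \<le> 1) sequentially"
    using order_tendstoD(2)[OF lim1, of 1] by (auto elim: eventually_mono)
  have ev2: "eventually (\<lambda>n. e n * w\<^sup>2 / 4 + \<tau>\<^sup>2 + y'\<^sup>2 \<le> w \<longleftrightarrow> \<tau>\<^sup>2 + y'\<^sup>2 \<le> w) sequentially"
  proof (cases "\<tau>\<^sup>2 + y'\<^sup>2 < w")
    case True
    then show ?thesis using order_tendstoD(2)[OF lim2 True] by (auto elim!: eventually_mono)
  next
    case False
    then have "w < \<tau>\<^sup>2 + y'\<^sup>2" using bd by simp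
    then show ?thesis using order_tendstoD(1)[OF lim2, of w] by (auto elim!: eventually_mono)
  qed
  have "L \<noteq> 0" using bd by (simp add: L_def)
  have ev3: "eventually (\<lambda>n. 0 \<le> f (e n) / e n + \<tau>\<^sup>2 + a\<^sup>2 * (y - y')\<^sup>2 \<longleftrightarrow> 0 \<le> L) sequentially"
  proof (cases "0 < L")
    case True
    then show ?thesis using order_tendstoD(1)[OF lim3, of 0] by (auto elim!: eventually_mono)
  next
    case False
    then have "L < 0" using \<open>L \<noteq> 0\<close> by simp
    then show ?thesis using order_tendstoD(2)[OF lim3, of 0] by (auto elim!: eventually_mono)
  qed
  have cond: "(2 - e n)\<^sup>2 \<le> (sqrt (1 - e n * s) + 1 - e n * w / 2)\<^sup>2 + e n * \<tau>\<^sup>2 + a\<^sup>2 * e n * (y - y')\<^sup>2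
      \<longleftrightarrow> 0 \<le> f (e n) / e n + \<tau>\<^sup>2 + a\<^sup>2 * (y - y')\<^sup>2" for n
  proof -
    have "f (e n) + e n * \<tau>\<^sup>2 + a\<^sup>2 * e n * (y - y')\<^sup>2 = e n * (f (e n) / e n + \<tau>\<^sup>2 + a\<^sup>2 * (y - y')\<^sup>2)"
      using e(1)[of n] by (simp add: field_simps)
    moreover have "0 \<le> \<dots> \<longleftrightarrow> 0 \<le> f (e n) / e n + \<tau>\<^sup>2 + a\<^sup>2 * (y - y')\<^sup>2"
      using e(1)[of n] by (simp add: zero_le_mult_iff)
    ultimately show ?thesis unfolding f_def by linarith
  qed
  show ?thesis
    using ev1 ev2 ev3
  proof eventually_elim
    case (elim n)
    then show ?case by (auto simp: near_set_def limit_set_def cond L_def)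
  qed
qed

lemma emeasure_near_set_limit:
  fixes e :: "nat \<Rightarrow> real"
  assumes a: "0 < a" "a < 1" and e: "\<And>n. 0 < e n" "\<And>n. e n \<le> (1 - a\<^sup>2) / 16" "e \<longlonglongrightarrow> 0"
  shows "(\<lambda>n. emeasure lborel (near_set a (e n))) \<longlonglongrightarrow> emeasure lborel (limit_set a)"
    and "emeasure lborel (limit_set a) < \<infinity>"
proof -
  define B where "B = 16 / (1 - a\<^sup>2)"
  define R where "R = cbox (- B, - B, - B, - B, - B) (B, B, B, B, B)"
  have Rm[measurable]: "R \<in> sets borel" by (simp add: R_def)
  have fin: "emeasure lborel R < \<infinity>" by (simp add: R_def emeasure_lborel_cbox_eq)
  have sub: "near_set a (e n) \<subseteq> R" for n
    using near_set_bounds[OF a e(1,2)] by (fastforce simp: R_def B_def)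
  have "(\<lambda>n. \<integral>\<^sup>+p. indicator (near_set a (e n)) p \<partial>lborel) \<longlonglongrightarrow> (\<integral>\<^sup>+p. indicator (limit_set a) p \<partial>lborel)"
  proof (rule nn_integral_dominated_convergence[where w="indicator R"])
    show "AE p in lborel. indicator (near_set a (e n)) p \<le> (indicator R p :: ennreal)" for n
      using sub[of n] by (intro AE_I2) (auto simp: indicator_def)
    show "(\<integral>\<^sup>+p. indicator R p \<partial>lborel) < \<infinity>" using fin by simp
    show "AE p in lborel. (\<lambda>n. indicator (near_set a (e n)) p) \<longlonglongrightarrow> (indicator (limit_set a) p :: ennreal)"
      using AE_not_limit_boundary[OF a(1)]
    proof eventually_elim
      case (elim p)
      obtain y s w \<tau> y' where p: "p = (y, s, w, \<tau>, y')" by (cases p) auto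
      show ?case
        by (rule tendsto_eventually, rule eventually_mono[OF near_set_pointwise_limit[where e=e and y=y and s=s and w=w and \<tau>=\<tau> and y'=y' and a=a]])
           (use elim e in \<open>auto simp: p indicator_def\<close>)
    qed
  qed simp_all
  then show lim: "(\<lambda>n. emeasure lborel (near_set a (e n))) \<longlonglongrightarrow> emeasure lborel (limit_set a)" by simp
  \<comment> \<open>Finiteness passes from the box to the limit of the volumes.\<close>
  have "emeasure lborel (limit_set a) \<le> emeasure lborel R"
    by (rule LIMSEQ_le_const2[OF lim]) (auto intro!: emeasure_mono sub)
  then show "emeasure lborel (limit_set a) < \<infinity>" using fin by (rule le_less_trans)
qed

section \<open>The limiting volume and \<open>I_const\<close>\<close>

definition G_set :: "real \<Rightarrow> (real \<times> real \<times> real \<times> real \<times> real) set" where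
  "G_set a = {p \<in> A_set. case p of (s, s', y, y', \<tau>) \<Rightarrow> G_fun a s s' y y' \<tau> \<le> 1}"

lemma G_set_sets [measurable]: "G_set a \<in> sets borel"
  unfolding G_set_def A_set_def G_fun_def case_prod_beta mem_Collect_eq
  by (intro borel_closed closed_Collect_conj closed_Collect_le continuous_intros) auto

text \<open>Both sides take the default value 0 if the volume is infinite; finiteness is established
  separately in \<open>emeasure_G_set\<close>.\<close>

lemma I_const_eq: "I_const a = measure lborel (G_set a)"
proof -
  have "I_const a = (LINT p|lborel. indicator (G_set a) p)"
    unfolding I_const_def set_lebesgue_integral_def
    by (intro Bochner_Integration.integral_cong) (auto simp: G_set_def indicator_def)
  then show ?thesis by simp
qed

text \<open>In the scaled coordinates of the second point, \<open>w\<close> measures \<open>1 - x\<close> along the axis through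
  the first point, while \<open>s'\<close> measures \<open>1 - r\<^sup>2\<close>; in the limit they differ by the shear
  \<open>w = s' + \<tau>\<^sup>2\<close>.\<close>

lemma emeasure_limit_set_eq: "emeasure lborel (limit_set a) = emeasure lborel (G_set a)"
proof -
  define f where "f s s' y y' \<tau> = (indicator (G_set a) (s, s', y, y', \<tau>) :: ennreal)" for s s' y y' \<tau>
  have f[measurable (raw)]: "(\<lambda>x. f (g1 x) (g2 x) (g3 x) (g4 x) (g5 x)) \<in> borel_measurable M"
    if [measurable]: "g1 \<in> borel_measurable M" "g2 \<in> borel_measurable M" "g3 \<in> borel_measurable M"
      "g4 \<in> borel_measurable M" "g5 \<in> borel_measurable M" for g1 g2 g3 g4 g5 and M :: "'b measure"
    unfolding f_def by measurable
  have eq: "f s (- \<tau>\<^sup>2 + 1 * w) y y' \<tau> = indicator (limit_set a) (y, s, w, \<tau>, y')" for s w y y' \<tau>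
  proof -
    have "y\<^sup>2 \<le> s \<Longrightarrow> 0 \<le> s" "y'\<^sup>2 \<le> w - \<tau>\<^sup>2 \<Longrightarrow> \<tau>\<^sup>2 \<le> w"
      using zero_le_power2[of y] zero_le_power2[of y'] by linarith+
    then show ?thesis
      by (auto simp: f_def G_set_def A_set_def G_fun_def limit_set_def indicator_def field_simps)
  qed
  have "emeasure lborel (G_set a) = (\<integral>\<^sup>+p. indicator (G_set a) p \<partial>lborel)" by simp
  also have "\<dots> = (\<integral>\<^sup>+s. \<integral>\<^sup>+s'. \<integral>\<^sup>+y. \<integral>\<^sup>+y'. \<integral>\<^sup>+\<tau>. f s s' y y' \<tau> \<partial>lborel \<partial>lborel \<partial>lborel \<partial>lborel \<partial>lborel)"
    unfolding f_def by (rule nn_integral_lborel_5) simp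
  \<comment> \<open>The exchanges move \<open>s'\<close> inside \<tau>: for fixed \<tau> the shear
    is a translation in \<open>s'\<close>, an affine substitution of slope 1.\<close>
  also have "\<dots> = (\<integral>\<^sup>+s. \<integral>\<^sup>+y. \<integral>\<^sup>+s'. \<integral>\<^sup>+y'. \<integral>\<^sup>+\<tau>. f s s' y y' \<tau> \<partial>lborel \<partial>lborel \<partial>lborel \<partial>lborel \<partial>lborel)"
    by (intro nn_integral_cong nn_integral_swap) (simp add: case_prod_beta)
  also have "\<dots> = (\<integral>\<^sup>+y. \<integral>\<^sup>+s. \<integral>\<^sup>+s'. \<integral>\<^sup>+y'. \<integral>\<^sup>+\<tau>. f s s' y y' \<tau> \<partial>lborel \<partial>lborel \<partial>lborel \<partial>lborel \<partial>lborel)"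
    by (intro nn_integral_swap) (simp add: case_prod_beta)
  also have "\<dots> = (\<integral>\<^sup>+y. \<integral>\<^sup>+s. \<integral>\<^sup>+s'. \<integral>\<^sup>+\<tau>. \<integral>\<^sup>+y'. f s s' y y' \<tau> \<partial>lborel \<partial>lborel \<partial>lborel \<partial>lborel \<partial>lborel)"
    by (intro nn_integral_cong nn_integral_swap) (simp add: case_prod_beta)
  also have "\<dots> = (\<integral>\<^sup>+y. \<integral>\<^sup>+s. \<integral>\<^sup>+\<tau>. \<integral>\<^sup>+s'. \<integral>\<^sup>+y'. f s s' y y' \<tau> \<partial>lborel \<partial>lborel \<partial>lborel \<partial>lborel \<partial>lborel)"
    by (intro nn_integral_cong nn_integral_swap) (simp add: case_prod_beta)
  also have "\<dots> = (\<integral>\<^sup>+y. \<integral>\<^sup>+s. \<integral>\<^sup>+\<tau>. ennreal \<bar>1\<bar> * (\<integral>\<^sup>+w. \<integral>\<^sup>+y'. f s (- \<tau>\<^sup>2 + 1 * w) y y' \<tau> \<partial>lborel \<partial>lborel) \<partial>lborel \<partial>lborel \<partial>lborel)"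
    by (intro nn_integral_cong nn_integral_real_affine) simp_all
  also have "\<dots> = (\<integral>\<^sup>+y. \<integral>\<^sup>+s. \<integral>\<^sup>+\<tau>. \<integral>\<^sup>+w. \<integral>\<^sup>+y'. indicator (limit_set a) (y, s, w, \<tau>, y') \<partial>lborel \<partial>lborel \<partial>lborel \<partial>lborel \<partial>lborel)"
    unfolding eq by simp
  also have "\<dots> = (\<integral>\<^sup>+y. \<integral>\<^sup>+s. \<integral>\<^sup>+w. \<integral>\<^sup>+\<tau>. \<integral>\<^sup>+y'. indicator (limit_set a) (y, s, w, \<tau>, y') \<partial>lborel \<partial>lborel \<partial>lborel \<partial>lborel \<partial>lborel)"
    by (intro nn_integral_cong nn_integral_swap) (simp add: case_prod_beta)
  also have "\<dots> = (\<integral>\<^sup>+p. indicator (limit_set a) p \<partial>lborel)"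
    by (rule nn_integral_lborel_5[symmetric]) simp
  finally show ?thesis by simp
qed

text \<open>Finiteness is inherited from \<open>limit_set\<close> along any admissible sequence
  \<open>e\<close>. Positivity is needed because the limit variable is built by dividing by
  \<Lambda>.\<close>

lemma emeasure_G_set:
  assumes a: "0 < a" "a < 1"
  shows "emeasure lborel (G_set a) = ennreal (I_const a)" and "0 < I_const a"
proof -
  define e where "e n = (1 - a\<^sup>2) / 16 / real (Suc n)" for n
  have d: "0 < 1 - a\<^sup>2" using a by (simp add: abs_square_less_1)
  have "emeasure lborel (limit_set a) < \<infinity>"
  proof (rule emeasure_near_set_limit(2)[OF a, of e])
    show "0 < e n" for n using d by (simp add: e_def)
    show "e n \<le> (1 - a\<^sup>2) / 16" for n
      using divide_left_mono[of 1 "real (Suc n)" "(1 - a\<^sup>2) / 16"] d by (simp add: e_def)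
    show "e \<longlonglongrightarrow> 0"
      unfolding e_def by (rule LIMSEQ_Suc[OF lim_const_over_n])
  qed
  then have fin: "emeasure lborel (G_set a) < \<infinity>" by (simp add: emeasure_limit_set_eq)
  then show "emeasure lborel (G_set a) = ennreal (I_const a)"
    unfolding I_const_eq by (intro emeasure_eq_ennreal_measure) auto
  \<comment> \<open>A box of positive volume inside the region: squares of \<open>y\<close> and
    \<open>y'\<close> are at most \<open>1/4\<close>, and the value of \<open>G_fun\<close> is at
    most \<open>1/2 + 1/4\<close>.\<close>
  define R where "R = cbox (1/4 :: real, 1/4 :: real, - 1/2 :: real, - 1/2 :: real, - 1 :: real) (1/2, 1/2, 1/2, 1/2, 1)"
  have "0 < measure lborel R"
    by (simp add: R_def content_Pair)
  also have "R \<subseteq> G_set a"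
  proof
    fix p assume "p \<in> R"
    moreover obtain s s' y y' \<tau> where p: "p = (s, s', y, y', \<tau>)" by (cases p) auto
    ultimately have b: "1/4 \<le> s" "s \<le> 1/2" "1/4 \<le> s'" "s' \<le> 1/2" "\<bar>y\<bar> \<le> 1/2" "\<bar>y'\<bar> \<le> 1/2" "\<bar>\<tau>\<bar> \<le> 1"
      by (auto simp: R_def)
    then have sq: "y\<^sup>2 \<le> 1/4" "y'\<^sup>2 \<le> 1/4" "\<tau>\<^sup>2 \<le> 1"
      using abs_le_square_iff[of y "1/2"] abs_le_square_iff[of y' "1/2"] abs_le_square_iff[of \<tau> 1]
      by (auto simp: power_divide)
    define Q where "Q = a\<^sup>2 / 4 * (y - y')\<^sup>2"
    have "0 \<le> Q" by (simp add: Q_def)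
    moreover have "s + s' \<le> 1" using b by simp
    ultimately have "(s + s') / 2 + \<tau>\<^sup>2 / 4 - Q \<le> 1" using sq(3) by argo
    moreover have "y\<^sup>2 \<le> s" "y'\<^sup>2 \<le> s'" using sq b by auto
    ultimately show "p \<in> G_set a"
      using b by (auto simp: p G_set_def A_set_def G_fun_def Q_def)
  qed
  then have "measure lborel R \<le> measure lborel (G_set a)"
    using fin by (intro measure_mono_fmeasurable) (auto simp: R_def fmeasurable_def)
  finally show "0 < I_const a" by (simp add: I_const_eq)
qed

section \<open>Convergence of the maximal distance\<close>

text \<open>Membership of \<open>x\<close> is added to \<open>far_set\<close> so that the relation
  is symmetric, as a relation on unordered pairs must be.\<close>

definition far_pairs :: "real \<Rightarrow> real \<Rightarrow> ((real ^ 3) \<times> (real ^ 3)) set" where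
  "far_pairs a \<epsilon> = {(x, y). x \<in> ellipsoid a \<and> y \<in> far_set a \<epsilon> x}"

lemma far_pairs_sets [measurable]: "far_pairs a \<epsilon> \<in> sets (borel \<Otimes>\<^sub>M borel)"
proof -
  have "{p. fst p \<in> ellipsoid a \<and> snd p \<in> ellipsoid a \<and> 2 - \<epsilon> \<le> norm (fst p - snd p)}
      \<in> sets (borel :: ((real ^ 3) \<times> (real ^ 3)) measure)"
    by measurable
  then show ?thesis unfolding far_pairs_def far_set_def case_prod_beta mem_Collect_eq borel_prod .
qed

lemma far_pairs_sym: "(x, y) \<in> far_pairs a \<epsilon> \<Longrightarrow> (y, x) \<in> far_pairs a \<epsilon>"
  by (auto simp: far_pairs_def far_set_def norm_minus_commute)

abbreviation (input) ellipsoid_measure :: "real \<Rightarrow> (real ^ 3) measure" where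
  "ellipsoid_measure a \<equiv> uniform_measure lborel (ellipsoid a)"

lemma emeasure_ellipsoid_measure_far:
  assumes a: "0 < a"
  shows "emeasure (ellipsoid_measure a) (Pair x -` far_pairs a \<epsilon>)
    = ennreal (3 / (4 * pi * a)) * (indicator (ellipsoid a) x * emeasure lborel (far_set a \<epsilon> x))"
proof -
  have "Pair x -` far_pairs a \<epsilon> = (if x \<in> ellipsoid a then far_set a \<epsilon> x else {})"
    by (auto simp: far_pairs_def)
  moreover have "ellipsoid a \<inter> far_set a \<epsilon> x = far_set a \<epsilon> x" by (auto simp: far_set_def)
  moreover have "u / ennreal (4 * pi * a / 3) = ennreal (3 / (4 * pi * a)) * u" for u
    using a by (simp add: divide_ennreal_def inverse_ennreal mult.commute)
  ultimately show ?thesis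
    by (simp add: emeasure_uniform_measure emeasure_ellipsoid[OF a])
qed

lemma prob_space_ellipsoid_measure: "0 < a \<Longrightarrow> prob_space (ellipsoid_measure a)"
  by (rule prob_space_uniform_measure) (simp_all add: emeasure_ellipsoid)

text \<open>Each uniform law contributes one normalization \<open>k = 3 / (4 * pi * a)\<close>; in
  \<open>k * (pi * a\<^sup>2 / 2) * k\<close> the parameter \<open>a\<close> cancels.\<close>

lemma measure_far_pairs:
  assumes a: "0 < a" "a < 1" and \<epsilon>: "0 < \<epsilon>" "\<epsilon> \<le> 2"
  shows "measure (ellipsoid_measure a \<Otimes>\<^sub>M ellipsoid_measure a) (far_pairs a \<epsilon>)
    = 9 / (32 * pi) * \<epsilon> powr (7 / 2) * measure lborel (near_set a \<epsilon>)"
proof -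
  interpret prob_space "ellipsoid_measure a" using a(1) by (rule prob_space_ellipsoid_measure)
  define k where "k = 3 / (4 * pi * a)"
  have k: "0 \<le> k" using a by (simp add: k_def)
  have "emeasure (ellipsoid_measure a \<Otimes>\<^sub>M ellipsoid_measure a) (far_pairs a \<epsilon>)
    = (\<integral>\<^sup>+x. emeasure (ellipsoid_measure a) (Pair x -` far_pairs a \<epsilon>) \<partial>ellipsoid_measure a)"
    by (rule emeasure_pair_measure_alt)
       (use far_pairs_sets[of a \<epsilon>] in \<open>simp cong: sets_pair_measure_cong\<close>)
  also have "\<dots> = (\<integral>\<^sup>+x. ennreal k * (indicator (ellipsoid a) x * emeasure lborel (far_set a \<epsilon> x)) \<partial>ellipsoid_measure a)"
    unfolding emeasure_ellipsoid_measure_far[OF a(1)] k_def ..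
  also have "\<dots> = (\<integral>\<^sup>+x. ennreal k * (indicator (ellipsoid a) x * emeasure lborel (far_set a \<epsilon> x)) * indicator (ellipsoid a) x \<partial>lborel)
      / emeasure lborel (ellipsoid a)"
    using a by (intro nn_integral_uniform_measure) (simp_all add: emeasure_ellipsoid)
  also have "(\<integral>\<^sup>+x. ennreal k * (indicator (ellipsoid a) x * emeasure lborel (far_set a \<epsilon> x)) * indicator (ellipsoid a) x \<partial>lborel)
      = (\<integral>\<^sup>+x. ennreal k * (indicator (ellipsoid a) x * emeasure lborel (far_set a \<epsilon> x)) \<partial>lborel)"
    by (intro nn_integral_cong) (simp add: indicator_def)
  also have "\<dots> = ennreal k * (ennreal (pi * a\<^sup>2 / 2 * \<epsilon> powr (7 / 2)) * emeasure lborel (near_set a \<epsilon>))"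
    by (subst nn_integral_cmult) (simp_all add: nn_integral_far_set[OF a \<epsilon>])
  finally have em: "emeasure (ellipsoid_measure a \<Otimes>\<^sub>M ellipsoid_measure a) (far_pairs a \<epsilon>)
    = ennreal k * (ennreal (pi * a\<^sup>2 / 2 * \<epsilon> powr (7 / 2)) * emeasure lborel (near_set a \<epsilon>)) * ennreal k"
    using a by (simp add: emeasure_ellipsoid divide_ennreal_def inverse_ennreal k_def)
  have "measure (ellipsoid_measure a \<Otimes>\<^sub>M ellipsoid_measure a) (far_pairs a \<epsilon>)
      = k * (pi * a\<^sup>2 / 2 * \<epsilon> powr (7 / 2) * measure lborel (near_set a \<epsilon>)) * k"
    unfolding measure_def em enn2real_mult using k by simp
  also have "\<dots> = (k * (pi * a\<^sup>2 / 2) * k) * \<epsilon> powr (7 / 2) * measure lborel (near_set a \<epsilon>)"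
    by (simp only: mult_ac)
  also have "k * (pi * a\<^sup>2 / 2) * k = 9 / (32 * pi)"
    using a by (simp add: k_def power2_eq_square)
  finally show ?thesis .
qed

text \<open>A shift of the index turns the eventual bounds on \<open>e\<close> into bounds for every
  index; finiteness of the limiting volume permits the passage to reals.\<close>

lemma measure_near_set_limit:
  fixes e :: "nat \<Rightarrow> real"
  assumes a: "0 < a" "a < 1" and pos: "eventually (\<lambda>n. 0 < e n) sequentially" and lim: "e \<longlonglongrightarrow> 0"
  shows "(\<lambda>n. measure lborel (near_set a (e n))) \<longlonglongrightarrow> I_const a"
proof -
  have "0 < (1 - a\<^sup>2) / 16" using a by (simp add: abs_square_less_1)
  from order_tendstoD(2)[OF lim this] pos
  have "eventually (\<lambda>n. 0 < e n \<and> e n \<le> (1 - a\<^sup>2) / 16) sequentially" by eventually_elim simp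
  then obtain N where N: "\<And>n. N \<le> n \<Longrightarrow> 0 < e n \<and> e n \<le> (1 - a\<^sup>2) / 16"
    by (auto simp: eventually_sequentially)
  have "(\<lambda>n. emeasure lborel (near_set a (e (n + N)))) \<longlonglongrightarrow> emeasure lborel (limit_set a)"
    using N LIMSEQ_ignore_initial_segment[OF lim] by (intro emeasure_near_set_limit(1)[OF a]) auto
  then have "(\<lambda>n. enn2real (emeasure lborel (near_set a (e (n + N))))) \<longlonglongrightarrow> I_const a"
    unfolding emeasure_limit_set_eq emeasure_G_set(1)[OF a]
    using emeasure_G_set(2)[OF a] by (intro tendsto_enn2real) auto
  then show ?thesis unfolding measure_def by (rule LIMSEQ_offset)
qed

text \<open>The scaling formula covers positive widths only, so width 0 is reached by monotonicity
  and a limit. The case \<open>t = 0\<close> of the main limit rests on it.\<close>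

lemma measure_far_pairs_0:
  assumes a: "0 < a" "a < 1"
  shows "measure (ellipsoid_measure a \<Otimes>\<^sub>M ellipsoid_measure a) (far_pairs a 0) = 0"
proof -
  interpret prob_space "ellipsoid_measure a" using a(1) by (rule prob_space_ellipsoid_measure)
  interpret pp: pair_prob_space "ellipsoid_measure a" "ellipsoid_measure a" ..
  define e where "e n = 1 / real (Suc n)" for n
  have e: "0 < e n" "e n \<le> 2" for n by (auto simp: e_def field_simps)
  have lim: "e \<longlonglongrightarrow> 0" unfolding e_def by (rule LIMSEQ_Suc[OF lim_const_over_n])
  have "(\<lambda>n. 9 / (32 * pi) * e n powr (7 / 2) * measure lborel (near_set a (e n)))
    \<longlonglongrightarrow> 9 / (32 * pi) * 0 powr (7 / 2) * I_const a"
    using e(1) by (intro tendsto_intros measure_near_set_limit a lim tendsto_powr2) (auto simp: less_imp_le)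
  then have lim0: "(\<lambda>n. 9 / (32 * pi) * e n powr (7 / 2) * measure lborel (near_set a (e n))) \<longlonglongrightarrow> 0" by simp
  have "measure (ellipsoid_measure a \<Otimes>\<^sub>M ellipsoid_measure a) (far_pairs a 0)
    \<le> 9 / (32 * pi) * e n powr (7 / 2) * measure lborel (near_set a (e n))" for n
    unfolding measure_far_pairs[OF a e, symmetric]
  proof (rule pp.finite_measure_mono)
    show "far_pairs a 0 \<subseteq> far_pairs a (e n)"
      using e(1)[of n] by (auto simp: far_pairs_def far_set_def)
    show "far_pairs a (e n) \<in> sets (ellipsoid_measure a \<Otimes>\<^sub>M ellipsoid_measure a)"
      using far_pairs_sets[of a "e n"] by (simp cong: sets_pair_measure_cong)
  qed
  then have "measure (ellipsoid_measure a \<Otimes>\<^sub>M ellipsoid_measure a) (far_pairs a 0) \<le> 0"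
    by (intro LIMSEQ_le_const[OF lim0]) auto
  then show ?thesis by (simp add: antisym)
qed

lemma void_probability_limit:
  fixes X :: "nat \<Rightarrow> 'w \<Rightarrow> real ^ 3"
  assumes a: "0 < a" "a < 1" and P: "prob_space P"
    and ind: "prob_space.indep_vars P (\<lambda>_. borel) X {1..}"
    and distr: "\<And>i. 1 \<le> i \<Longrightarrow> distr P borel (X i) = ellipsoid_measure a" and t: "0 \<le> t"
  shows "(\<lambda>n. measure P {\<omega> \<in> space P. \<forall>i j. 1 \<le> i \<and> i < j \<and> j \<le> n \<longrightarrow>
      (X i \<omega>, X j \<omega>) \<notin> far_pairs a (t * real n powr (- 4 / 7))})
    \<longlonglongrightarrow> exp (- (9 / (64 * pi) * I_const a) * t powr (7 / 2))"
proof -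
  interpret P: prob_space P by fact
  interpret E: prob_space "ellipsoid_measure a" using a(1) by (rule prob_space_ellipsoid_measure)
  define void where "void n \<epsilon> = measure P {\<omega> \<in> space P. \<forall>i j. 1 \<le> i \<and> i < j \<and> j \<le> n \<longrightarrow>
      (X i \<omega>, X j \<omega>) \<notin> far_pairs a \<epsilon>}" for n \<epsilon>
  define p where "p \<epsilon> = measure (ellipsoid_measure a \<Otimes>\<^sub>M ellipsoid_measure a) (far_pairs a \<epsilon>)" for \<epsilon>
  have approx: "\<bar>void n \<epsilon> - exp (- (real (n choose 2) * p \<epsilon>))\<bar>
      \<le> real (n choose 2) * (real (2 * n) * (p \<epsilon> * b) + real (2 * n) * (p \<epsilon>)\<^sup>2)"
    if "0 \<le> b" "\<And>x. measure (ellipsoid_measure a) (Pair x -` far_pairs a \<epsilon>) \<le> b" for n \<epsilon> b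
    unfolding void_def p_def
  proof (rule P.iid_pairs_void_probability[OF ind distr far_pairs_sets far_pairs_sym _ that(1)])
    show "measure (ellipsoid_measure a) {y \<in> space borel. (x, y) \<in> far_pairs a \<epsilon>} \<le> b" for x
      using that(2)[of x] by (simp add: vimage_def)
  qed
  show ?thesis
  \<comment> \<open>At \<open>t = 0\<close> the width is 0 for every \<open>n\<close>; the
    single-pair probability vanishes, and the error bound gives void probability exactly 1.\<close>
  proof (cases "t = 0")
    case True
    have "void n 0 = 1" for n
      using approx[of 1 0 n] E.prob_le_1 by (simp add: p_def measure_far_pairs_0[OF a])
    then show ?thesis using True by (simp add: void_def)
  next
    case False
    define e where "e n = t * real n powr (- 4 / 7)" for n
    have epos: "0 < e n" if "1 \<le> n" for n using that False t by (simp add: e_def)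
    have e0: "e \<longlonglongrightarrow> 0" unfolding e_def by real_asymp
    obtain C where C: "0 \<le> C" "\<And>\<epsilon> x. 0 < \<epsilon> \<Longrightarrow> \<epsilon> \<le> (1 - a\<^sup>2) / 16 \<Longrightarrow> x \<in> ellipsoid a \<Longrightarrow>
      emeasure lborel (far_set a \<epsilon> x) \<le> ennreal (C * \<epsilon>\<^sup>2)"
      using emeasure_far_set_le[OF a] by blast
    define C' where "C' = 3 / (4 * pi * a) * C"
    have C': "0 \<le> C'" using a C by (simp add: C'_def)
    \<comment> \<open>For \<open>x\<close> outside the ellipsoid the section is empty, so the bound
      holds at every \<open>x\<close>.\<close>
    have sec: "measure (ellipsoid_measure a) (Pair x -` far_pairs a \<epsilon>) \<le> C' * \<epsilon>\<^sup>2"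
      if \<epsilon>: "0 < \<epsilon>" "\<epsilon> \<le> (1 - a\<^sup>2) / 16" for x \<epsilon>
    proof -
      have "emeasure (ellipsoid_measure a) (Pair x -` far_pairs a \<epsilon>)
        \<le> ennreal (3 / (4 * pi * a)) * ennreal (C * \<epsilon>\<^sup>2)"
        unfolding emeasure_ellipsoid_measure_far[OF a(1)]
        using C(2)[OF \<epsilon>, of x] by (intro mult_left_mono) (auto simp: indicator_def)
      also have "\<dots> = ennreal (C' * \<epsilon>\<^sup>2)"
        using a C by (simp add: C'_def ennreal_mult[symmetric])
      finally show ?thesis using C' by (simp add: E.emeasure_eq_measure)
    qed
    define m where "m n = measure lborel (near_set a (e n))" for n
    have m: "m \<longlonglongrightarrow> I_const a"
      unfolding m_def
      by (rule measure_near_set_limit[OF a _ e0]) (auto intro!: eventually_sequentiallyI[of 1] epos)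
    have "0 < (1 - a\<^sup>2) / 16" using a by (simp add: abs_square_less_1)
    from order_tendstoD(2)[OF e0 this]
    have small: "eventually (\<lambda>n. 1 \<le> n \<and> e n \<le> (1 - a\<^sup>2) / 16) sequentially"
      using eventually_ge_at_top[of 1] by eventually_elim simp
    \<comment> \<open>The rate \<open>4 / 7\<close> is the one for which the power
      \<open>7 / 2\<close> of the width is a multiple of \<open>1 / n\<^sup>2\<close>.\<close>
    have pm: "p (e n) = 9 / (32 * pi) * t powr (7 / 2) * m n / (real n)\<^sup>2"
      if "1 \<le> n" "e n \<le> (1 - a\<^sup>2) / 16" for n
    proof -
      have "e n \<le> 2" using that(2) zero_le_power2[of a] by argo
      moreover have "e n powr (7 / 2) = t powr (7 / 2) / (real n)\<^sup>2"
      proof -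
        have "(real n powr (- 4 / 7)) powr (7 / 2) = 1 / (real n)\<^sup>2"
        proof -
          have "(real n powr (- 4 / 7)) powr (7 / 2) = real n powr (- 4 / 7 * (7 / 2))" by (rule powr_powr)
          also have "- 4 / 7 * (7 / 2) = (- 2 :: real)" by simp
          also have "real n powr - 2 = 1 / (real n)\<^sup>2" using that(1) by (simp add: powr_minus_divide)
          finally show ?thesis .
        qed
        then show ?thesis using t by (simp add: e_def powr_mult)
      qed
      ultimately show ?thesis
        using measure_far_pairs[OF a epos[OF that(1)]] by (simp add: p_def m_def)
    qed
    define L where "L = 9 / (32 * pi) * t powr (7 / 2)"
    have half: "(\<lambda>n. real (n choose 2) / (real n)\<^sup>2) \<longlonglongrightarrow> 1 / 2"
    proof -
      have eq: "real (n choose 2) = real n * (real n - 1) / 2" for n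
        by (cases n) (auto simp: choose_two real_of_nat_div algebra_simps)
      show ?thesis unfolding eq by real_asymp
    qed
    have lim1: "(\<lambda>n. real (n choose 2) * p (e n)) \<longlonglongrightarrow> L * I_const a / 2"
    proof (rule Lim_transform_eventually)
      show "(\<lambda>n. L * m n * (real (n choose 2) / (real n)\<^sup>2)) \<longlonglongrightarrow> L * I_const a / 2"
        using tendsto_mult[OF tendsto_mult[OF tendsto_const[of L] m] half] by simp
      show "eventually (\<lambda>n. L * m n * (real (n choose 2) / (real n)\<^sup>2) = real (n choose 2) * p (e n)) sequentially"
        using small by eventually_elim (simp add: pm L_def)
    qed
    have lim2: "(\<lambda>n. real (2 * n) * p (e n)) \<longlonglongrightarrow> 0"
    proof (rule Lim_transform_eventually)
      have "(\<lambda>n. L * m n * (2 / real n)) \<longlonglongrightarrow> L * I_const a * 0"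
        by (intro tendsto_mult tendsto_const m) real_asymp
      then show "(\<lambda>n. L * m n * (2 / real n)) \<longlonglongrightarrow> 0" by simp
      show "eventually (\<lambda>n. L * m n * (2 / real n) = real (2 * n) * p (e n)) sequentially"
        using small by eventually_elim (simp add: pm L_def power2_eq_square)
    qed
    have lim3: "(\<lambda>n. real (2 * n) * (C' * (e n)\<^sup>2)) \<longlonglongrightarrow> 0"
    proof -
      have "(\<lambda>n. real n * (real n powr (- 4 / 7))\<^sup>2) \<longlonglongrightarrow> 0" by real_asymp
      from tendsto_mult_right_zero[OF this, of "2 * C' * t\<^sup>2"] show ?thesis
        unfolding e_def power_mult_distrib by (simp only: of_nat_mult of_nat_numeral mult_ac)
    qed
    \<comment> \<open>The expected number of far pairs converges, so only the bracket has to
      vanish.\<close>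
    have err: "(\<lambda>n. real (n choose 2) * p (e n) * (real (2 * n) * (C' * (e n)\<^sup>2) + real (2 * n) * p (e n))) \<longlonglongrightarrow> 0"
      using tendsto_mult[OF lim1 tendsto_add[OF lim3 lim2]] by simp
    have "(\<lambda>n. void n (e n) - exp (- (real (n choose 2) * p (e n)))) \<longlonglongrightarrow> 0"
    proof (rule Lim_null_comparison[OF _ err])
      show "eventually (\<lambda>n. norm (void n (e n) - exp (- (real (n choose 2) * p (e n))))
        \<le> real (n choose 2) * p (e n) * (real (2 * n) * (C' * (e n)\<^sup>2) + real (2 * n) * p (e n))) sequentially"
        using small
      proof eventually_elim
        case (elim n)
        show ?case
          using approx[of "C' * (e n)\<^sup>2" "e n" n] sec[of "e n"] epos[of n] C' elim
          by (simp add: power2_eq_square algebra_simps)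
      qed
    qed
    then have "(\<lambda>n. (void n (e n) - exp (- (real (n choose 2) * p (e n)))) + exp (- (real (n choose 2) * p (e n))))
      \<longlonglongrightarrow> 0 + exp (- (L * I_const a / 2))"
      by (intro tendsto_add tendsto_exp tendsto_minus lim1)
    then show ?thesis by (simp add: void_def e_def L_def mult_ac)
  qed
qed

text \<open>The limit law is realized as a power of a standard exponential variable: the tail at
  \<open>t\<close> is the exponential tail at \<open>\<Lambda> * t powr (7 / 2)\<close>. As
  \<open>Q\<close> lives on all reals, \<open>max 0\<close> sends the null set of negative points to
  0.\<close>

lemma weibull_tail:
  fixes \<Lambda> t :: real
  assumes \<Lambda>: "0 < \<Lambda>" and t: "0 \<le> t"
  defines "Q \<equiv> density lborel (exponential_density 1)"
  shows "measure Q {x \<in> space Q. t < (max 0 x / \<Lambda>) powr (2 / 7)} = exp (- \<Lambda> * t powr (7 / 2))"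
proof -
  interpret prob_space Q unfolding Q_def by (rule prob_space_exponential_density) simp
  have "t < (max 0 x / \<Lambda>) powr (2 / 7) \<longleftrightarrow> \<Lambda> * t powr (7 / 2) < x" for x
  proof -
    have inv: "(t powr (7 / 2)) powr (2 / 7) = t" using t by (simp add: powr_powr)
    have "0 \<le> \<Lambda> * t powr (7 / 2)" using \<Lambda> by simp
    then have "\<Lambda> * t powr (7 / 2) < x \<longleftrightarrow> \<Lambda> * t powr (7 / 2) < max 0 x" by auto
    also have "\<dots> \<longleftrightarrow> t powr (7 / 2) < max 0 x / \<Lambda>" using \<Lambda> by (simp add: pos_less_divide_eq mult.commute)
    also have "\<dots> \<longleftrightarrow> (t powr (7 / 2)) powr (2 / 7) < (max 0 x / \<Lambda>) powr (2 / 7)"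
    proof
      assume "(t powr (7 / 2)) powr (2 / 7) < (max 0 x / \<Lambda>) powr (2 / 7)"
      moreover have "0 \<le> max 0 x / \<Lambda>" using \<Lambda> by simp
      ultimately show "t powr (7 / 2) < max 0 x / \<Lambda>"
        using powr_mono2[of "2 / 7" "max 0 x / \<Lambda>" "t powr (7 / 2)"] by (meson divide_nonneg_pos linorder_not_le zero_le_numeral zero_less_numeral)
    qed (intro powr_less_mono2, auto)
    finally show ?thesis unfolding inv ..
  qed
  moreover have "distributed Q lborel (\<lambda>x. x) (exponential_density 1)"
    unfolding distributed_def Q_def by (auto simp: distr_id2)
  then have "prob {x \<in> space Q. \<Lambda> * t powr (7 / 2) < x} = exp (- (\<Lambda> * t powr (7 / 2)) * 1)"
    using \<Lambda> by (intro exponential_distributedD_gt) auto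
  ultimately show ?thesis by simp
qed

theorem theorem1p1:
  fixes a :: real and P :: "'w measure" and X :: "nat \<Rightarrow> 'w \<Rightarrow> real ^ 3"
  assumes "0 < a" and "a < 1"
    and "prob_space P"
    and "prob_space.indep_vars P (\<lambda>_. borel) X {1..}"
    and "\<And>i. 1 \<le> i \<Longrightarrow> distr P borel (X i) = uniform_measure lborel (ellipsoid a)"
  shows "\<exists>\<Lambda> :: real.
    (\<exists>(Q :: real measure) (Z :: real \<Rightarrow> real). prob_space Q \<and> Z \<in> borel_measurable Q \<and>
      weak_conv_m
        (\<lambda>n. distr P borel (\<lambda>\<omega>. real n powr (4 / 7) * (2 - max_interpoint_dist X n \<omega>)))
        (distr Q borel Z) \<and>
      (\<forall>t\<ge>0. measure Q {\<omega> \<in> space Q. Z \<omega> > t} = exp (- \<Lambda> * t powr (7 / 2)))) \<and>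
    \<Lambda> = 9 / (64 * pi) * I_const a"
proof -
  note a = assms(1,2)
  interpret P: prob_space P by fact
  have X[measurable]: "X i \<in> borel_measurable P" if "1 \<le> i" for i
    using assms(4) that unfolding P.indep_vars_def by auto
  define \<Lambda> where "\<Lambda> = 9 / (64 * pi) * I_const a"
  have \<Lambda>: "0 < \<Lambda>" using emeasure_G_set(2)[OF a] by (simp add: \<Lambda>_def)
  define Q where "Q = density lborel (exponential_density 1)"
  define Z where "Z x = (max 0 x / \<Lambda>) powr (2 / 7)" for x :: real
  interpret Q: prob_space Q unfolding Q_def by (rule prob_space_exponential_density) simp
  have Zm[measurable]: "Z \<in> borel_measurable Q" unfolding Z_def Q_def by measurable
  have tail: "measure Q {\<omega> \<in> space Q. t < Z \<omega>} = exp (- \<Lambda> * t powr (7 / 2))" if "0 \<le> t" for t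
    unfolding Q_def Z_def by (rule weibull_tail[OF \<Lambda> that])
  define Y where "Y n \<omega> = real n powr (4 / 7) * (2 - max_interpoint_dist X n \<omega>)" for n \<omega>
  define I where "I n = {(i, j). 1 \<le> i \<and> i < j \<and> j \<le> n}" for n :: nat
  have finI: "finite (I n)" for n
    by (rule finite_subset[of _ "{1..n} \<times> {1..n}"]) (auto simp: I_def)
  have neI: "I n \<noteq> {}" if "2 \<le> n" for n
  proof -
    have "(1, 2) \<in> I n" using that by (simp add: I_def)
    then show ?thesis by auto
  qed
  have max_eq: "max_interpoint_dist X n \<omega> = Max ((\<lambda>q. norm (X (fst q) \<omega> - X (snd q) \<omega>)) ` I n)" for n \<omega>
    unfolding max_interpoint_dist_def I_def by (rule arg_cong[where f=Max]) (auto simp: image_iff, blast+)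
  \<comment> \<open>For \<open>n < 2\<close> the maximum over the empty set is one fixed value,
    hence constant in \<omega> and measurable.\<close>
  have Ym: "Y n \<in> borel_measurable P" for n
  proof -
    have "(\<lambda>\<omega>. Max ((\<lambda>q. norm (X (fst q) \<omega> - X (snd q) \<omega>)) ` I n)) \<in> borel_measurable P"
      by (intro borel_measurable_Max finI borel_measurable_norm borel_measurable_diff X) (auto simp: I_def)
    then show ?thesis unfolding Y_def max_eq by measurable
  qed
  \<comment> \<open>The law of each point gives membership in the ellipsoid only almost surely;
    countably many indices share one null set.\<close>
  have inE: "AE \<omega> in P. \<forall>i\<in>{1..}. X i \<omega> \<in> ellipsoid a"
  proof (subst AE_ball_countable)
    show "\<forall>i\<in>{1..}. AE \<omega> in P. X i \<omega> \<in> ellipsoid a"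
    proof
      fix i :: nat assume "i \<in> {1..}"
      then have i: "1 \<le> i" by simp
      have "AE x in uniform_measure lborel (ellipsoid a). x \<in> ellipsoid a"
        by (rule AE_uniform_measureI) auto
      then have "AE x in distr P borel (X i). x \<in> ellipsoid a" unfolding assms(5)[OF i] .
      then show "AE \<omega> in P. X i \<omega> \<in> ellipsoid a" using X[OF i] by (subst (asm) AE_distr_iff) auto
    qed
  qed simp
  \<comment> \<open>\<open>Y n\<close> exceeds \<open>t\<close> exactly when no pair is far at width
    \<open>t * n powr (- 4 / 7)\<close>. The equivalence holds almost surely, since
    \<open>far_pairs\<close> also records membership in the ellipsoid; \<open>2 \<le> n\<close>
    makes the maximum genuine.\<close>
  have tailY: "measure P {\<omega> \<in> space P. t < Y n \<omega>} = measure P {\<omega> \<in> space P.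
      \<forall>i j. 1 \<le> i \<and> i < j \<and> j \<le> n \<longrightarrow> (X i \<omega>, X j \<omega>) \<notin> far_pairs a (t * real n powr (- 4 / 7))}"
    if n: "2 \<le> n" for n t
  proof (rule P.finite_measure_eq_AE)
    define \<epsilon> where "\<epsilon> = t * real n powr (- 4 / 7)"
    show "AE \<omega> in P. \<omega> \<in> {\<omega> \<in> space P. t < Y n \<omega>} \<longleftrightarrow> \<omega> \<in> {\<omega> \<in> space P.
      \<forall>i j. 1 \<le> i \<and> i < j \<and> j \<le> n \<longrightarrow> (X i \<omega>, X j \<omega>) \<notin> far_pairs a (t * real n powr (- 4 / 7))}"
      using inE
    proof eventually_elim
      case (elim \<omega>)
      have n0: "0 < real n powr (4 / 7)" using n by simp
      have "t < Y n \<omega> \<longleftrightarrow> t / real n powr (4 / 7) < 2 - max_interpoint_dist X n \<omega>"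
        unfolding Y_def using n0 by (simp add: pos_divide_less_eq mult.commute)
      also have "t / real n powr (4 / 7) = \<epsilon>" by (simp add: \<epsilon>_def powr_minus_divide)
      also have "\<epsilon> < 2 - max_interpoint_dist X n \<omega> \<longleftrightarrow> max_interpoint_dist X n \<omega> < 2 - \<epsilon>" by auto
      also have "\<dots> \<longleftrightarrow> (\<forall>q\<in>I n. norm (X (fst q) \<omega> - X (snd q) \<omega>) < 2 - \<epsilon>)"
        unfolding max_eq using finI neI[OF n] by (subst Max_less_iff) auto
      also have "\<dots> \<longleftrightarrow> (\<forall>i j. 1 \<le> i \<and> i < j \<and> j \<le> n \<longrightarrow> (X i \<omega>, X j \<omega>) \<notin> far_pairs a \<epsilon>)"
        using elim by (auto simp: I_def far_pairs_def far_set_def not_le)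
      finally show ?case unfolding \<epsilon>_def by simp
    qed
    show "{\<omega> \<in> space P. t < Y n \<omega>} \<in> P.events" using Ym by measurable
    have "{\<omega> \<in> space P. \<forall>q\<in>I n. (X (fst q) \<omega>, X (snd q) \<omega>) \<notin> far_pairs a (t * real n powr (- 4 / 7))} \<in> P.events"
    proof (intro sets.sets_Collect_finite_All sets.sets_Collect_neg finI)
      fix q assume "q \<in> I n"
      then have [measurable]: "X (fst q) \<in> borel_measurable P" "X (snd q) \<in> borel_measurable P"
        by (auto simp: I_def intro!: X)
      show "{\<omega> \<in> space P. (X (fst q) \<omega>, X (snd q) \<omega>) \<in> far_pairs a (t * real n powr (- 4 / 7))} \<in> P.events"
        by measurable
    qed
    then show "{\<omega> \<in> space P. \<forall>i j. 1 \<le> i \<and> i < j \<and> j \<le> n \<longrightarrow>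
        (X i \<omega>, X j \<omega>) \<notin> far_pairs a (t * real n powr (- 4 / 7))} \<in> P.events"
      by (simp add: I_def)
  qed
  \<comment> \<open>Stated for an arbitrary sample space because it serves both \<open>P\<close> and
    \<open>Q\<close>.\<close>
  have cdf_tail: "cdf (distr M borel V) t = 1 - measure M {\<omega> \<in> space M. t < V \<omega>}"
    if "prob_space M" and [measurable]: "V \<in> borel_measurable M" for M :: "'v measure" and V :: "'v \<Rightarrow> real" and t
  proof -
    interpret M: prob_space M by fact
    have "cdf (distr M borel V) t = measure M (V -` {..t} \<inter> space M)"
      by (simp add: cdf_def measure_distr)
    also have "V -` {..t} \<inter> space M = space M - {\<omega> \<in> space M. t < V \<omega>}" by auto
    also have "measure M \<dots> = 1 - measure M {\<omega> \<in> space M. t < V \<omega>}" by (rule M.prob_compl) measurable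
    finally show ?thesis .
  qed
  have "weak_conv_m (\<lambda>n. distr P borel (Y n)) (distr Q borel Z)"
    unfolding weak_conv_m_def weak_conv_def
  proof (intro allI impI)
    fix t :: real
    have "(\<lambda>n. measure P {\<omega> \<in> space P. t < Y n \<omega>}) \<longlonglongrightarrow> measure Q {\<omega> \<in> space Q. t < Z \<omega>}"
    proof (cases "0 \<le> t")
      case True
      have "(\<lambda>n. measure P {\<omega> \<in> space P. \<forall>i j. 1 \<le> i \<and> i < j \<and> j \<le> n \<longrightarrow>
          (X i \<omega>, X j \<omega>) \<notin> far_pairs a (t * real n powr (- 4 / 7))}) \<longlonglongrightarrow> exp (- \<Lambda> * t powr (7 / 2))"
        unfolding \<Lambda>_def using assms(3-5) True by (intro void_probability_limit[OF a])
      then show ?thesis unfolding tail[OF True]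
        by (rule Lim_transform_eventually) (auto intro!: eventually_sequentiallyI[of 2] simp: tailY)
    next
      \<comment> \<open>For negative \<open>t\<close> both tails equal 1, as the ellipsoid lies in
        the unit ball and distances are at most 2, while \<open>Z\<close> is nonnegative.\<close>
      case False
      have "measure P {\<omega> \<in> space P. t < Y n \<omega>} = 1" if n: "2 \<le> n" for n
      proof -
        have "AE \<omega> in P. t < Y n \<omega>"
          using inE
        proof eventually_elim
          case (elim \<omega>)
          have "norm (X i \<omega> - X j \<omega>) \<le> 2" if "(i, j) \<in> I n" for i j
          proof -
            have "norm (X i \<omega>) \<le> 1" "norm (X j \<omega>) \<le> 1"
              using elim that by (auto simp: I_def intro!: ellipsoid_norm_le[OF a])
            then show ?thesis using norm_triangle_ineq4[of "X i \<omega>" "X j \<omega>"] by simp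
          qed
          then have "max_interpoint_dist X n \<omega> \<le> 2"
            unfolding max_eq using finI neI[OF n] by (subst Max_le_iff) auto
          then have "0 \<le> Y n \<omega>" by (simp add: Y_def)
          then show ?case using False by simp
        qed
        then show ?thesis by (subst P.prob_Collect_eq_1) (use Ym in measurable)
      qed
      moreover have "measure Q {\<omega> \<in> space Q. t < Z \<omega>} = 1"
      proof -
        have "t < Z \<omega>" for \<omega>
          unfolding Z_def using False by (intro less_le_trans[OF _ powr_ge_zero]) auto
        then show ?thesis by (simp add: Q.prob_space)
      qed
      ultimately show ?thesis
        by (intro tendsto_eventually) (auto intro!: eventually_sequentiallyI[of 2])
    qed
    then show "(\<lambda>n. cdf (distr P borel (Y n)) t) \<longlonglongrightarrow> cdf (distr Q borel Z) t"
      unfolding cdf_tail[OF P.prob_space_axioms Ym] cdf_tail[OF Q.prob_space_axioms Zm]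
      by (intro tendsto_diff tendsto_const)
  qed
  then show ?thesis
    unfolding Y_def \<Lambda>_def[symmetric] using Q.prob_space_axioms Zm tail by blast
qed

end
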